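(* For an arbitrary partition $\lambda=(\lambda_1,\lambda_2,\dots,\lambda_l)\vdash n$, \[ Q_{\lambda}(X;t)=\sum_{k=0}^{n-\lambda_1}\ \sum_{\mu\in C_{\lambda^{[1]}}^{\,n-\lambda_1-k}}Q_{\lambda^{[1]}/\mu}(-1;t)\,q_{\lambda_1+k}(X;t)\,Q_{\mu}(X;t). \]
   Context: $Q_\lambda(X;t)$ denotes the Hall–Littlewood function (the Macdonald function $Q_\lambda(X;q,t)$ at $q=0$), $P_\lambda(X;t)$ the dual Hall–Littlewood functions with respect to $\langle p_\lambda,p_\mu\rangle_t=\delta_{\lambda\mu}z_\lambda\prod_i(1-t^{\lambda_i})^{-1}$, and $Q_{\lambda/\mu}(X;t)$ the skew Hall–Littlewood function $\sum_\nu f^\lambda_{\mu\nu}(t)Q_\nu(X;t)$, where $f^\lambda_{\mu\nu}(t)$ is the coefficient of $P_\lambda$ in $P_\mu P_\nu$. $Q_{\lambda/\mu}(-1;t)$ is the image of $Q_{\lambda/\mu}(X;t)$ under the ring homomorphism $p_n\mapsto -1$ on power sums ($\lambda$-ring notation). $q_n(X;t)$ is defined by $\sum_{n\ge0}q_n(X;t)z^n=\exp\big(\sum_{n\ge1}\frac{1-t^n}{n}p_nz^n\big)$, i.e. $q_n=Q_{(n)}(X;t)$. For $\lambda=(\lambda_1,\dots,\lambda_l)$, $\lambda^{[1]}=(\lambda_2,\dots,\lambda_l)$, and $C^i_\lambda=\{\mu\vdash i:\mu\subset\lambda\}$. *)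

theory Defs
  imports "HOL-Library.Multiset" "HOL-Library.Poly_Mapping" "HOL-Library.FuncSet"
    "HOL-Computational_Algebra.Polynomial" "HOL-Computational_Algebra.Fraction_Field"
begin

definition is_partition :: "nat multiset \<Rightarrow> bool" where
  "is_partition lam \<longleftrightarrow> (\<forall>i \<in># lam. 0 < i)"

definition partitions :: "nat \<Rightarrow> nat multiset set" where
  "partitions n = {lam. is_partition lam \<and> sum_mset lam = n}"

definition parts :: "nat multiset \<Rightarrow> nat list" where
  "parts lam = rev (sorted_list_of_multiset lam)"

text \<open>part lam i = lambda_(i+1) (0-indexed), zero beyond the length.\<close>
definition part :: "nat multiset \<Rightarrow> nat \<Rightarrow> nat" where
  "part lam i = (if i < length (parts lam) then parts lam ! i else 0)"

definition ptail :: "nat multiset \<Rightarrow> nat multiset" where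
  "ptail lam = mset (tl (parts lam))"

definition pcontained :: "nat multiset \<Rightarrow> nat multiset \<Rightarrow> bool" where
  "pcontained mu lam \<longleftrightarrow> (\<forall>i. part mu i \<le> part lam i)"

definition Cset :: "nat \<Rightarrow> nat multiset \<Rightarrow> nat multiset set" where
  "Cset i lam = {mu \<in> partitions i. pcontained mu lam}"

definition dominated :: "nat multiset \<Rightarrow> nat multiset \<Rightarrow> bool" where
  "dominated mu lam \<longleftrightarrow> sum_mset mu = sum_mset lam \<and>
     (\<forall>k. (\<Sum>i<k. part mu i) \<le> (\<Sum>i<k. part lam i))"

text \<open>Lambda_K (over a field K of characteristic 0) is the polynomial algebra K[p_1,p_2,...].
  An element is represented by its finitely supported coefficient function on the
  power-sum basis p_lam (lam a partition); the convolution product of the monoid algebra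
  over (nat multiset, +) is the product p_lam p_mu = p_(lam + mu).\<close>

type_synonym 'a sym = "nat multiset \<Rightarrow>\<^sub>0 'a"

definition valid_sym :: "'a::zero sym \<Rightarrow> bool" where
  "valid_sym f \<longleftrightarrow> (\<forall>lam \<in> Poly_Mapping.keys f. is_partition lam)"

definition psym :: "nat multiset \<Rightarrow> 'a::{zero,one} sym" where
  "psym lam = Poly_Mapping.single lam 1"

definition scal :: "'a::semiring_1 \<Rightarrow> 'a sym \<Rightarrow> 'a sym" where
  "scal c f = Poly_Mapping.single {#} c * f"

definition zee :: "nat multiset \<Rightarrow> nat" where
  "zee lam = (\<Prod>i \<in> set_mset lam. i ^ count lam i * fact (count lam i))"

definition hall :: "'a::field \<Rightarrow> 'a sym \<Rightarrow> 'a sym \<Rightarrow> 'a" where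
  "hall t f g = (\<Sum>lam \<in> Poly_Mapping.keys f \<inter> Poly_Mapping.keys g.
      Poly_Mapping.lookup f lam * Poly_Mapping.lookup g lam * of_nat (zee lam) / (\<Prod>i\<in>#lam. 1 - t ^ i))"

text \<open>The ring homomorphism p_n |-> -1 (plethystic evaluation at X = -1).\<close>
definition ev_neg1 :: "'a::ring_1 sym \<Rightarrow> 'a" where
  "ev_neg1 f = (\<Sum>lam \<in> Poly_Mapping.keys f. Poly_Mapping.lookup f lam * (- 1) ^ size lam)"

text \<open>q_n(X;t): the coefficient of z^n in exp(sum_(n>=1) (1-t^n)/n p_n z^n),
  written out: q_n = sum_(lam |- n) z_lam^(-1) prod_i (1 - t^lam_i) p_lam.\<close>
definition qfun :: "'a::field \<Rightarrow> nat \<Rightarrow> 'a sym" where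
  "qfun t n = (\<Sum>lam \<in> partitions n.
      scal ((\<Prod>i\<in>#lam. 1 - t ^ i) / of_nat (zee lam)) (psym lam))"

text \<open>Exponent vectors alpha of monomials x^alpha in countably many variables x_0,x_1,...
  [x^alpha] p_lam = number of ways to assign to each part of lam a variable index j
  such that the parts assigned to j sum to alpha_j.\<close>
definition pcoeff :: "nat multiset \<Rightarrow> (nat \<Rightarrow>\<^sub>0 nat) \<Rightarrow> nat" where
  "pcoeff lam alpha = card {g \<in> {0..<length (parts lam)} \<rightarrow>\<^sub>E Poly_Mapping.keys alpha.
      \<forall>j. (\<Sum>i \<in> {i. i < length (parts lam) \<and> g i = j}. parts lam ! i) = Poly_Mapping.lookup alpha j}"

definition mcoeff :: "'a::semiring_1 sym \<Rightarrow> (nat \<Rightarrow>\<^sub>0 nat) \<Rightarrow> 'a" where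
  "mcoeff f alpha = (\<Sum>lam \<in> Poly_Mapping.keys f. Poly_Mapping.lookup f lam * of_nat (pcoeff lam alpha))"

definition expo_part :: "(nat \<Rightarrow>\<^sub>0 nat) \<Rightarrow> nat multiset" where
  "expo_part alpha = image_mset (Poly_Mapping.lookup alpha) (mset_set (Poly_Mapping.keys alpha))"

text \<open>P_lam(X;t) = m_lam + sum_(mu < lam) u_(lam mu)(t) m_mu, pairwise orthogonal for <,>_t.
  In terms of monomial coefficients: [x^alpha] P_lam = 1 if the sorted alpha is lam,
  and = 0 unless the sorted alpha is dominated by lam.\<close>
definition HL_P_family :: "'a::field \<Rightarrow> (nat multiset \<Rightarrow> 'a sym) \<Rightarrow> bool" where
  "HL_P_family t P \<longleftrightarrow>
     (\<forall>lam. \<not> is_partition lam \<longrightarrow> P lam = 0) \<and>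
     (\<forall>lam. is_partition lam \<longrightarrow> valid_sym (P lam) \<and>
        (\<forall>alpha. expo_part alpha = lam \<longrightarrow> mcoeff (P lam) alpha = 1) \<and>
        (\<forall>alpha. \<not> dominated (expo_part alpha) lam \<longrightarrow> mcoeff (P lam) alpha = 0)) \<and>
     (\<forall>lam mu. is_partition lam \<and> is_partition mu \<and> lam \<noteq> mu \<longrightarrow> hall t (P lam) (P mu) = 0)"

definition HL_P :: "'a::field \<Rightarrow> nat multiset \<Rightarrow> 'a sym" where
  "HL_P t = (THE P. HL_P_family t P)"

definition HL_Q :: "'a::field \<Rightarrow> nat multiset \<Rightarrow> 'a sym" where
  "HL_Q t lam = scal (inverse (hall t (HL_P t lam) (HL_P t lam))) (HL_P t lam)"

text \<open>coefficient of P_lam in a homogeneous f of degree |lam|\<close>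
definition Pcoeff :: "'a::field \<Rightarrow> 'a sym \<Rightarrow> nat multiset \<Rightarrow> 'a" where
  "Pcoeff t f lam = (THE c. \<exists>a. (\<forall>k. k \<notin> partitions (sum_mset lam) \<longrightarrow> a k = 0) \<and>
      f = (\<Sum>k \<in> partitions (sum_mset lam). scal (a k) (HL_P t k)) \<and> c = a lam)"

definition fLR :: "'a::field \<Rightarrow> nat multiset \<Rightarrow> nat multiset \<Rightarrow> nat multiset \<Rightarrow> 'a" where
  "fLR t lam mu nu = Pcoeff t (HL_P t mu * HL_P t nu) lam"

text \<open>Q_(lam/mu) = sum_nu f^lam_(mu nu) Q_nu (only |nu| = |lam| - |mu| contribute)\<close>
definition HL_skewQ :: "'a::field \<Rightarrow> nat multiset \<Rightarrow> nat multiset \<Rightarrow> 'a sym" where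
  "HL_skewQ t lam mu = (if sum_mset mu \<le> sum_mset lam then
      (\<Sum>nu \<in> partitions (sum_mset lam - sum_mset mu). scal (fLR t lam mu nu) (HL_Q t nu))
    else 0)"

definition tvar :: "rat poly fract" where
  "tvar = Fract [:0, 1:] 1"

end

theory Submission
  imports Defs
begin

text \<open>
  Expanding $f[X - u]$ in the basis $Q_\mu$ shows that the right-hand side is the result of applying
  the coefficient of $z^{\lambda_1}$ in Jing's vertex operator
  $f \mapsto \exp(\sum_r \frac{1-t^r}{r} p_r z^r) f[X - 1/z]$ to $Q_{\lambda^{[1]}}$. So it has to be shown that
  the iterated vertex operators applied to 1 produce the functions $Q_\lambda$ characterised by
  orthogonality and triangularity. Composing a vertex operator with the adjoint of another one, in
  either order, gives sums of the same normally ordered coefficients; this yields orthogonality and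
  the nonzero norms. Triangularity follows because a vertex operator only raises products of the
  $q_n$ in the dominance order, and these products are dual to the monomial functions. Finally,
  the restriction to $\mu \subset \lambda^{[1]}$ follows from the exchange relation of two
  vertex operators, by which $q_r Q_\mu$ is a combination of $Q_\lambda$ with $\lambda \supset \mu$.
\<close>

text \<open>The sign \<open>e\<close> in \<open>qz\<close>, \<open>transl\<close> and
  \<open>vop\<close> is there for adjunction: the adjoint of \<open>transl e k\<close> is
  multiplication by \<open>qz (- e) k\<close>, so the adjoint of a vertex operator of index n is
  again a vertex operator, with \<open>- e\<close> and -n. One composition formula,
  \<open>vop_vop\<close>, therefore serves both relations. For two operators of the same sign the
  scalar factor is (1 - u)/(1 - t u), which leads to the exchange relation; for opposite signs it is
  (1 - t u)/(1 - u), which leads to the relation with the adjoint. The values at -1 come from the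
  same adjunction: in degree k the map p_n -> -1 is the pairing with \<open>qz (- 1) k\<close>, so
  Q_{nu/mu}(-1) is the pairing of Q_nu with \<open>qz (- 1) k\<close> times P_mu, which is the
  coefficient of Q_mu in \<open>transl 1 k\<close> of Q_nu. The series involved are infinite in z
  and 1/z. All identities are stated for single coefficients with integer indices, where a negative
  index of \<open>qz\<close> gives 0 and the degree bounds the translations; this is why cut-offs
  such as D and K accompany every sum.\<close>

abbreviation lookup :: "('a \<Rightarrow>\<^sub>0 'b::zero) \<Rightarrow> 'a \<Rightarrow> 'b" where "lookup \<equiv> Poly_Mapping.lookup"
abbreviation keys :: "('a \<Rightarrow>\<^sub>0 'b::zero) \<Rightarrow> 'a set" where "keys \<equiv> Poly_Mapping.keys"

abbreviation pvar :: "nat \<Rightarrow> 'a::{zero,one} sym" where "pvar r \<equiv> psym {#r#}"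

declare of_nat_sum_mset [simp del]

section \<open>The power-sum algebra\<close>

lemma lookup_single_times:
  fixes f :: "'a::semiring_1 sym"
  shows "lookup (Poly_Mapping.single mu a * f) lam =
    (if mu \<subseteq># lam then a * lookup f (lam - mu) else 0)"
proof -
  have "lookup (Poly_Mapping.single mu a * f) lam = a * (\<Sum>q. (lookup f q when lam = mu + q))"
    by (simp add: lookup_mult lookup_single when_mult)
  also have "\<dots> = (if mu \<subseteq># lam then a * lookup f (lam - mu) else 0)"
  proof (cases "mu \<subseteq># lam")
    case True
    then have "(lam = mu + q) = (q = lam - mu)" for q
      by (metis add_diff_cancel_left' subset_mset.add_diff_inverse)
    then show ?thesis using True by simp
  next
    case False
    then have "(lam = mu + q) = False" for q by auto
    then show ?thesis using False by simp
  qed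
  finally show ?thesis .
qed

lemma lookup_scal [simp]: "lookup (scal c f) lam = c * lookup f lam"
  by (simp add: scal_def lookup_single_times)

lemma lookup_psym: "lookup (psym mu) lam = (if mu = lam then 1 else 0)"
  by (simp add: psym_def lookup_single)

lemma lookup_psym_times:
  "lookup (psym mu * f) lam = (if mu \<subseteq># lam then lookup (f :: 'a::semiring_1 sym) (lam - mu) else 0)"
  by (simp add: psym_def lookup_single_times)

text \<open>This provides \<open>sym.span\<close>, in which triangularity and containment are
  expressed.\<close>

interpretation sym: vector_space "scal :: 'a::field \<Rightarrow> 'a sym \<Rightarrow> 'a sym"
  by unfold_locales (auto intro!: poly_mapping_eqI simp: lookup_add algebra_simps)

lemma scal_mult_left [simp]: "scal c f * g = scal c (f * (g :: 'a::comm_semiring_1 sym))"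
  by (simp add: scal_def mult.assoc)

lemma scal_mult_right [simp]: "f * scal c g = scal c (f * (g :: 'a::comm_semiring_1 sym))"
  by (simp add: scal_def mult.left_commute)

lemma psym_empty [simp]: "psym {#} = 1"
  by (simp add: psym_def)

lemma psym_add_mset: "psym (add_mset r lam) = pvar r * (psym lam :: 'a::semiring_1 sym)"
  by (simp add: psym_def mult_single)

lemma sym_expand: "(f :: 'a::field sym) = (\<Sum>lam\<in>keys f. scal (lookup f lam) (psym lam))"
proof (rule poly_mapping_eqI)
  fix mu
  have "(\<Sum>lam\<in>keys f. lookup f lam * (if lam = mu then 1 else 0)) = lookup f mu"
    by (cases "mu \<in> keys f") (auto simp: in_keys_iff if_distrib sum.delta' cong: if_cong)
  then show "lookup f mu = lookup (\<Sum>lam\<in>keys f. scal (lookup f lam) (psym lam)) mu"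
    by (simp add: lookup_sum lookup_psym)
qed

section \<open>Grading and validity\<close>

text \<open>The degree is an integer because translations and adjoint operators may lower it below
  zero, where only 0 is homogeneous.\<close>

definition homog :: "int \<Rightarrow> 'a::zero sym set" where
  "homog d = {f. \<forall>lam\<in>keys f. is_partition lam \<and> int (sum_mset lam) = d}"

text \<open>The p_r with r > 0 generate the algebra, so a linear property need only survive
  multiplication by one of them. Derivatives and translations have simple rules for exactly this
  step.\<close>

lemma sym_valid_induct [consumes 1, case_names one mult add scal]:
  fixes f :: "'a::field sym"
  assumes "valid_sym f"
    and one: "P 1"
    and mult: "\<And>r g. 0 < r \<Longrightarrow> valid_sym g \<Longrightarrow> P g \<Longrightarrow> P (pvar r * g)"
    and add: "\<And>g h. P g \<Longrightarrow> P h \<Longrightarrow> P (g + h)"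
    and scal: "\<And>c g. P g \<Longrightarrow> P (scal c g)"
  shows "P f"
proof -
  have psym: "is_partition lam \<Longrightarrow> P (psym lam)" for lam
  proof (induction lam)
    case empty
    then show ?case by (simp add: one)
  next
    case (add r lam)
    then have "valid_sym (psym lam :: 'a sym)" "0 < r" "P (psym lam)"
      by (auto simp: valid_sym_def psym_def is_partition_def)
    then show ?case unfolding psym_add_mset[of r lam] by (intro mult)
  qed
  have P0: "P 0" using scal[OF one, of 0] by simp
  have "(\<forall>lam\<in>A. P (g lam)) \<Longrightarrow> P (sum g A)" if "finite A" for A :: "nat multiset set" and g
    using that by (induction A rule: finite_induct) (auto intro: add P0)
  note sum = this
  have "P (\<Sum>lam\<in>keys f. scal (lookup f lam) (psym lam))"
    by (rule sum[OF finite_keys]) (use assms(1) in \<open>auto simp: valid_sym_def intro!: scal psym\<close>)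
  then show ?thesis by (simp only: sym_expand[symmetric])
qed

lemma valid_sym_iff: "valid_sym f \<longleftrightarrow> (\<forall>lam. \<not> is_partition lam \<longrightarrow> lookup f lam = 0)"
  by (auto simp: valid_sym_def in_keys_iff)

lemma is_partition_empty [simp]: "is_partition {#}"
  by (simp add: is_partition_def)

lemma is_partition_add_mset [simp]: "is_partition (add_mset r lam) \<longleftrightarrow> 0 < r \<and> is_partition lam"
  by (auto simp: is_partition_def)

lemma is_partition_plus [simp]: "is_partition (lam + mu) \<longleftrightarrow> is_partition lam \<and> is_partition mu"
  by (auto simp: is_partition_def)

lemma homog_iff:
  "f \<in> homog d \<longleftrightarrow> (\<forall>lam. is_partition lam \<and> int (sum_mset lam) = d \<or> lookup f lam = 0)"
  by (auto simp: homog_def in_keys_iff)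

lemma valid_homog: "f \<in> homog d \<Longrightarrow> valid_sym f"
  by (auto simp: homog_def valid_sym_def)

lemma homog_0 [simp]: "0 \<in> homog d"
  by (simp add: homog_iff)

lemma homog_1 [simp]: "(1 :: 'a::zero_neq_one sym) \<in> homog 0"
  by (auto simp: homog_iff lookup_one)

lemma homog_neg: "f \<in> homog d \<Longrightarrow> d < 0 \<Longrightarrow> f = 0"
  by (rule poly_mapping_eqI) (auto simp: homog_iff)

lemma homog_add: "f \<in> homog d \<Longrightarrow> g \<in> homog d \<Longrightarrow> f + g \<in> homog d"
  by (force simp: homog_iff lookup_add)

lemma homog_diff: "f \<in> homog d \<Longrightarrow> g \<in> homog d \<Longrightarrow> f - (g::'a::ab_group_add sym) \<in> homog d"
  by (force simp: homog_iff lookup_minus)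

lemma homog_scal: "f \<in> homog d \<Longrightarrow> scal c f \<in> homog d"
  by (force simp: homog_iff)

lemma homog_sum: "(\<And>i. i \<in> A \<Longrightarrow> g i \<in> homog d) \<Longrightarrow> sum g A \<in> homog d"
  by (induction A rule: infinite_finite_induct) (auto intro: homog_add)

lemma homog_mult:
  "f \<in> homog d \<Longrightarrow> g \<in> homog d' \<Longrightarrow> (f::'a::semiring_1 sym) * g \<in> homog (d + d')"
  using keys_mult[of f g] by (fastforce simp: homog_def)

lemma homog_psym: "is_partition lam \<Longrightarrow> (psym lam::'a::zero_neq_one sym) \<in> homog (int (sum_mset lam))"
  by (auto simp: homog_iff lookup_psym)

lemma valid_sym_0 [simp]: "valid_sym 0"
  by (simp add: valid_sym_iff)

lemma valid_sym_1 [simp]: "valid_sym (1 :: 'a::zero_neq_one sym)"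
  using valid_homog[OF homog_1] .

lemma valid_sym_add: "valid_sym f \<Longrightarrow> valid_sym g \<Longrightarrow> valid_sym (f + g)"
  by (force simp: valid_sym_iff lookup_add)

lemma valid_sym_diff: "valid_sym f \<Longrightarrow> valid_sym g \<Longrightarrow> valid_sym (f - (g::'a::ab_group_add sym))"
  by (force simp: valid_sym_iff lookup_minus)

lemma valid_sym_scal: "valid_sym f \<Longrightarrow> valid_sym (scal c f)"
  by (force simp: valid_sym_iff)

lemma valid_sym_sum: "(\<And>i. i \<in> A \<Longrightarrow> valid_sym (g i)) \<Longrightarrow> valid_sym (sum g A)"
  by (induction A rule: infinite_finite_induct) (auto intro: valid_sym_add)

lemma valid_sym_mult: "valid_sym f \<Longrightarrow> valid_sym g \<Longrightarrow> valid_sym (f * (g::'a::semiring_1 sym))"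
  using keys_mult[of f g] by (fastforce simp: valid_sym_def)

lemma homog_induct [consumes 1, case_names psym zero add scal]:
  fixes f :: "'a::field sym"
  assumes "f \<in> homog d"
    and psym: "\<And>lam. is_partition lam \<Longrightarrow> int (sum_mset lam) = d \<Longrightarrow> P (psym lam)"
    and zero: "P 0"
    and add: "\<And>g h. P g \<Longrightarrow> P h \<Longrightarrow> P (g + h)"
    and scal: "\<And>c g. P g \<Longrightarrow> P (scal c g)"
  shows "P f"
proof -
  have "(\<forall>lam\<in>A. P (g lam)) \<Longrightarrow> P (sum g A)" if "finite A" for A :: "nat multiset set" and g
    using that by (induction A rule: finite_induct) (auto intro: add zero)
  note sum = this
  have "P (\<Sum>lam\<in>keys f. scal (lookup f lam) (psym lam))"
    by (rule sum[OF finite_keys]) (use assms(1) in \<open>auto simp: homog_def intro!: scal psym\<close>)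
  then show ?thesis by (simp only: sym_expand[symmetric])
qed

lemma finite_partitions [simp]: "finite (partitions n)"
proof (rule finite_subset)
  show "partitions n \<subseteq> mset ` {xs. set xs \<subseteq> {..n} \<and> length xs \<le> n}"
  proof
    fix lam assume "lam \<in> partitions n"
    then have pos: "\<forall>i\<in>#lam. 0 < i" and sum: "sum_mset lam = n"
      by (auto simp: partitions_def is_partition_def)
    obtain xs where xs: "mset xs = lam" using ex_mset by blast
    have "\<forall>x\<in>set xs. 0 < x" using pos xs by (metis set_mset_mset)
    then have "length xs \<le> sum_list xs" by (induction xs) fastforce+
    moreover have "sum_list xs = n" using sum xs sum_mset_sum_list by metis
    moreover have "x \<le> n" if "x \<in> set xs" for x
      using member_le_sum_list[OF that] \<open>sum_list xs = n\<close> by simp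
    ultimately show "lam \<in> mset ` {xs. set xs \<subseteq> {..n} \<and> length xs \<le> n}" using xs by auto
  qed
qed (auto intro: finite_lists_length_le)

text \<open>Only the factor at r changes, from r^m m! to r^(m+1) (m+1)!.\<close>

lemma zee_add_mset:
  "zee (add_mset r lam) = zee lam * (r * Suc (count lam r))"
proof (cases "r \<in># lam")
  case True
  define g :: "nat multiset \<Rightarrow> nat \<Rightarrow> nat" where "g mu i = i ^ count mu i * fact (count mu i)" for mu i
  have "zee (add_mset r lam) = g (add_mset r lam) r * prod (g (add_mset r lam)) (set_mset lam - {r})"
    using True by (simp add: zee_def g_def insert_absorb prod.remove)
  also have "prod (g (add_mset r lam)) (set_mset lam - {r}) = prod (g lam) (set_mset lam - {r})"
    by (rule prod.cong) (auto simp: g_def)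
  also have "g (add_mset r lam) r = r * Suc (count lam r) * g lam r"
    by (simp add: g_def algebra_simps)
  also have "r * Suc (count lam r) * g lam r * prod (g lam) (set_mset lam - {r}) = r * Suc (count lam r) * zee lam"
    using True by (simp add: zee_def g_def prod.remove mult.assoc)
  finally show ?thesis by (simp only: mult_ac)
next
  case False
  then have "count lam r = 0" by (simp add: not_in_iff)
  moreover have "(\<Prod>i\<in>set_mset lam. i ^ count (add_mset r lam) i * fact (count (add_mset r lam) i)) = zee lam"
    unfolding zee_def by (rule prod.cong) (use False in auto)
  ultimately show ?thesis using False
    by (simp add: zee_def)
qed

lemma zee_nonzero: "is_partition lam \<Longrightarrow> zee lam \<noteq> 0"
  by (auto simp: zee_def is_partition_def)

subsection \<open>Partial derivatives\<close>

text \<open>The formal derivative with respect to p_r, read off on coefficients: p_r occurs in the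
  monomial of \<open>add_mset r lam\<close> with exponent \<open>Suc (count lam r)\<close>.\<close>

definition pderiv_sym :: "nat \<Rightarrow> 'a::semiring_1 sym \<Rightarrow> 'a sym" where
  "pderiv_sym r f = Poly_Mapping.Abs_poly_mapping
     (\<lambda>lam. of_nat (Suc (count lam r)) * lookup f (add_mset r lam))"

lemma lookup_pderiv_sym:
  "lookup (pderiv_sym r f) lam = of_nat (Suc (count lam r)) * lookup f (add_mset r lam)"
proof -
  have "finite ((\<lambda>lam. add_mset r lam) -` keys f)"
    by (intro finite_vimageI) (auto simp: inj_on_def)
  then have "finite {lam. of_nat (Suc (count lam r)) * lookup f (add_mset r lam) \<noteq> 0}"
    by (rule rev_finite_subset) (auto simp: in_keys_iff simp del: of_nat_Suc)
  then show ?thesis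
    by (simp add: pderiv_sym_def Poly_Mapping.lookup_Abs_poly_mapping del: of_nat_Suc)
qed

lemma pderiv_sym_add: "pderiv_sym r (f + g) = pderiv_sym r f + pderiv_sym r g"
  by (rule poly_mapping_eqI) (simp add: lookup_pderiv_sym lookup_add algebra_simps)

lemma pderiv_sym_diff: "pderiv_sym r (f - g) = pderiv_sym r f - pderiv_sym r (g :: 'a::ring_1 sym)"
  using pderiv_sym_add[of r "f - g" g] by simp

lemma pderiv_sym_scal: "pderiv_sym r (scal c f) = scal c (pderiv_sym r (f::'a::comm_semiring_1 sym))"
  by (rule poly_mapping_eqI) (simp add: lookup_pderiv_sym algebra_simps)

lemma pderiv_sym_0 [simp]: "pderiv_sym r 0 = 0"
  by (rule poly_mapping_eqI) (simp add: lookup_pderiv_sym)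

lemma pderiv_sym_1 [simp]: "pderiv_sym r 1 = 0"
  by (rule poly_mapping_eqI) (simp add: lookup_pderiv_sym lookup_one)

lemma pderiv_sym_sum: "pderiv_sym r (sum g A) = (\<Sum>i\<in>A. pderiv_sym r (g i))"
  by (induction A rule: infinite_finite_induct) (auto simp: pderiv_sym_add)

lemma pderiv_sym_pvar_mult:
  fixes f :: "'a::comm_semiring_1 sym"
  shows "pderiv_sym r (pvar s * f) = pvar s * pderiv_sym r f + (if s = r then f else 0)"
proof (rule poly_mapping_eqI)
  fix lam
  show "lookup (pderiv_sym r (pvar s * f)) lam =
    lookup (pvar s * pderiv_sym r f + (if s = r then f else 0)) lam"
  proof (cases "s \<in># lam")
    case True
    then obtain mu where "lam = add_mset s mu" by (metis insert_DiffM)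
    moreover have "add_mset r (add_mset s mu) - {#s#} = add_mset r mu"
      by (simp add: add_mset_commute[of r s])
    ultimately show ?thesis
      by (cases "s = r") (simp_all add: lookup_pderiv_sym lookup_add lookup_psym_times distrib_right add_ac)
  next
    case False
    moreover from False have "count lam s = 0" by (simp add: not_in_iff)
    ultimately show ?thesis
      by (auto simp: lookup_pderiv_sym lookup_add lookup_psym_times)
  qed
qed

lemma pderiv_sym_mult:
  fixes f g :: "'a::field sym"
  assumes "valid_sym f"
  shows "pderiv_sym r (f * g) = pderiv_sym r f * g + f * pderiv_sym r g"
  using assms
proof (induction f rule: sym_valid_induct)
  case (mult s h)
  then show ?case
    by (cases "s = r") (simp_all add: mult.assoc pderiv_sym_pvar_mult distrib_left distrib_right)
qed (simp_all add: pderiv_sym_add pderiv_sym_scal distrib_left distrib_right sym.scale_right_distrib)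

lemma pderiv_sym_prod:
  fixes g :: "'b \<Rightarrow> 'a::field sym"
  assumes "finite A" "\<And>i. i \<in> A \<Longrightarrow> valid_sym (g i)"
  shows "pderiv_sym r (prod g A) = (\<Sum>i\<in>A. pderiv_sym r (g i) * prod g (A - {i}))"
  using assms
proof (induction A rule: finite_induct)
  case (insert x A)
  have "insert x A - {i} = insert x (A - {i})" if "i \<in> A" for i using insert that by auto
  moreover have "x \<notin> A - {i}" for i using insert by auto
  ultimately have *: "prod g (insert x A - {i}) = g x * prod g (A - {i})" if "i \<in> A" for i
    using insert that by (simp add: prod.insert)
  have "pderiv_sym r (prod g (insert x A)) =
    pderiv_sym r (g x) * prod g A + g x * (\<Sum>i\<in>A. pderiv_sym r (g i) * prod g (A - {i}))"
    using insert by (simp add: pderiv_sym_mult)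
  also have "g x * (\<Sum>i\<in>A. pderiv_sym r (g i) * prod g (A - {i})) =
    (\<Sum>i\<in>A. pderiv_sym r (g i) * prod g (insert x A - {i}))"
    unfolding sum_distrib_left by (rule sum.cong) (simp_all add: * mult.left_commute)
  finally show ?case using insert by simp
qed simp

text \<open>Every coefficient except the constant one is, up to a nonzero integer, a coefficient of
  some derivative. Identities between the q series are proved by this principle instead of by
  manipulating exponentials.\<close>

lemma sym_eq_0_pderiv:
  fixes f :: "'a::field_char_0 sym"
  assumes "valid_sym f" "lookup f {#} = 0" "\<And>r. 0 < r \<Longrightarrow> pderiv_sym r f = 0"
  shows "f = 0"
proof (rule poly_mapping_eqI)
  fix lam
  show "lookup f lam = lookup 0 lam"
  proof (cases lam)
    case empty
    then show ?thesis using assms by simp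
  next
    case (add r mu)
    show ?thesis
    proof (cases "r = 0")
      case True
      then show ?thesis using assms(1) add by (auto simp: valid_sym_iff)
    next
      case False
      then have "lookup (pderiv_sym r f) mu = 0" using assms by simp
      then show ?thesis using add by (simp add: lookup_pderiv_sym del: of_nat_Suc)
    qed
  qed
qed

section \<open>The Hall-Littlewood scalar product\<close>

text \<open>The assumption keeps the weights 1/(1 - t^i) of the scalar product meaningful and the
  norms of the Hall-Littlewood functions nonzero.\<close>

locale hall_littlewood =
  fixes t :: "'a::field_char_0"
  assumes t_power: "0 < i \<Longrightarrow> t ^ i \<noteq> 1"
begin

lemma one_minus_t_power [simp]: "0 < i \<Longrightarrow> 1 - t ^ i \<noteq> 0"
  using t_power by simp

definition pnorm :: "nat multiset \<Rightarrow> 'a" where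
  "pnorm lam = of_nat (zee lam) / (\<Prod>i\<in>#lam. 1 - t ^ i)"

lemma hall_superset:
  assumes "finite A" "keys f \<inter> keys g \<subseteq> A"
  shows "hall t f g = (\<Sum>lam\<in>A. lookup f lam * lookup g lam * pnorm lam)"
  unfolding hall_def pnorm_def times_divide_eq_right
  by (rule sum.mono_neutral_left) (use assms in \<open>auto simp: in_keys_iff\<close>)

lemma hall_commute: "hall t f g = hall t g f"
  unfolding hall_def by (intro sum.cong) auto

lemma hall_add_left: "hall t (f + g) h = hall t f h + hall t g h"
  using keys_add[of f g]
  by (subst (1 2 3) hall_superset[where A = "keys f \<union> keys g"])
    (auto simp: lookup_add sum.distrib algebra_simps)

lemma hall_scal_left [simp]: "hall t (scal c f) h = c * hall t f h"
  by (subst (1 2) hall_superset[where A = "keys h"])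
    (auto simp: sum_distrib_left mult.assoc)

lemma hall_0_left [simp]: "hall t 0 h = 0"
  by (simp add: hall_def)

lemma hall_minus_left: "hall t (f - g) h = hall t f h - hall t g h"
  using hall_add_left[of "f - g" g h] by simp

lemma hall_sum_left: "hall t (sum f A) h = (\<Sum>i\<in>A. hall t (f i) h)"
  by (induction A rule: infinite_finite_induct) (auto simp: hall_add_left)

lemma hall_add_right: "hall t h (f + g) = hall t h f + hall t h g"
  by (metis hall_add_left hall_commute)

lemma hall_scal_right [simp]: "hall t h (scal c f) = c * hall t h f"
  by (metis hall_scal_left hall_commute)

lemma hall_0_right [simp]: "hall t h 0 = 0"
  by (simp add: hall_def)

lemma hall_minus_right: "hall t h (f - g) = hall t h f - hall t h g"
  by (metis hall_minus_left hall_commute)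

lemma hall_sum_right: "hall t h (sum f A) = (\<Sum>i\<in>A. hall t h (f i))"
  by (induction A rule: infinite_finite_induct) (auto simp: hall_add_right)

lemma hall_psym_left: "hall t (psym lam) g = lookup g lam * pnorm lam"
  by (subst hall_superset[where A = "{lam}"]) (auto simp: psym_def)

lemma hall_1_left: "hall t 1 g = lookup g {#}"
  using hall_psym_left[of "{#}" g] by (simp add: pnorm_def zee_def)

lemma pnorm_add_mset:
  "pnorm (add_mset r lam) = pnorm lam * (of_nat r * of_nat (Suc (count lam r)) / (1 - t ^ r))"
  by (simp add: pnorm_def zee_add_mset mult.commute del: of_nat_Suc mult_Suc_right)

lemma pnorm_nonzero: "is_partition lam \<Longrightarrow> pnorm lam \<noteq> 0"
proof (induction lam)
  case empty
  then show ?case by (simp add: pnorm_def zee_def)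
next
  case (add r lam)
  then show ?case using t_power by (simp add: pnorm_add_mset del: of_nat_Suc)
qed

lemma hall_nondegenerate:
  assumes "valid_sym f" "\<And>g. valid_sym g \<Longrightarrow> hall t f g = 0"
  shows "f = 0"
proof (rule poly_mapping_eqI)
  fix lam
  show "lookup f lam = lookup 0 lam"
  proof (cases "is_partition lam")
    case True
    then have "hall t (psym lam) f = 0"
      using assms(2)[OF valid_homog[OF homog_psym]] hall_commute by metis
    then show ?thesis using True pnorm_nonzero by (simp add: hall_psym_left)
  qed (use assms in \<open>auto simp: valid_sym_iff\<close>)
qed

lemma hall_homog_orthogonal:
  assumes "f \<in> homog d" "g \<in> homog d'" "d \<noteq> d'"
  shows "hall t f g = 0"
  using assms by (subst hall_superset[where A = "{}"]) (auto simp: homog_def)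

text \<open>On power sums this is the quotient of the norms of p_r p_lam and p_lam. Hence the
  adjoint of multiplication by p_r is a multiple of the derivative in p_r.\<close>

lemma hall_pvar_mult: "hall t (pvar r * f) g = of_nat r / (1 - t ^ r) * hall t f (pderiv_sym r g)"
proof -
  have *: "hall t (pvar r * psym lam) g = of_nat r / (1 - t ^ r) * hall t (psym lam) (pderiv_sym r g)" for lam
    unfolding psym_add_mset[symmetric]
    by (simp add: hall_psym_left pnorm_add_mset lookup_pderiv_sym del: of_nat_Suc)
  have "hall t (pvar r * (\<Sum>lam\<in>A. scal (lookup f lam) (psym lam))) g =
    of_nat r / (1 - t ^ r) * hall t (\<Sum>lam\<in>A. scal (lookup f lam) (psym lam)) (pderiv_sym r g)" for A
    by (simp add: sum_distrib_left hall_sum_left * mult.left_commute)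
  from this[of "keys f"] show ?thesis by (simp only: sym_expand[symmetric])
qed

end

context hall_littlewood
begin

section \<open>The functions q and the translation operators\<close>

definition qcoef :: "'a \<Rightarrow> nat multiset \<Rightarrow> 'a" where
  "qcoef e lam = (\<Prod>i\<in>#lam. e * (1 - t ^ i)) / of_nat (zee lam)"

text \<open>The coefficient of z^n in exp(e sum_r (1-t^r)/r p_r z^r). For e = 1 it is q_n, for e =
  -1 the inverse series.\<close>

definition qz :: "'a \<Rightarrow> int \<Rightarrow> 'a sym" where
  "qz e n = (if n < 0 then 0 else \<Sum>lam\<in>partitions (nat n). scal (qcoef e lam) (psym lam))"

lemma qz_1_eq_qfun: "qz 1 (int n) = qfun t n"
  by (simp add: qz_def qfun_def qcoef_def)

lemma lookup_qz:
  "lookup (qz e n) lam = (if is_partition lam \<and> int (sum_mset lam) = n then qcoef e lam else 0)"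
proof (cases "n < 0")
  case False
  have "(\<Sum>mu\<in>partitions (nat n). qcoef e mu * (if mu = lam then 1 else 0)) =
    (\<Sum>mu\<in>partitions (nat n). if mu = lam then qcoef e mu else 0)"
    by (rule sum.cong) auto
  also have "\<dots> = (if lam \<in> partitions (nat n) then qcoef e lam else 0)" by simp
  finally have "lookup (qz e n) lam = (if lam \<in> partitions (nat n) then qcoef e lam else 0)" using False
    by (simp add: qz_def lookup_sum lookup_psym)
  then show ?thesis using False by (auto simp: partitions_def)
qed (auto simp: qz_def)

lemma qcoef_add_mset:
  assumes "0 < r"
  shows "of_nat r * of_nat (Suc (count lam r)) * qcoef e (add_mset r lam) = e * (1 - t ^ r) * qcoef e lam"
proof -
  have nz: "(of_nat r :: 'a) * of_nat (Suc (count lam r)) \<noteq> 0"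
    using assms by (simp del: of_nat_Suc)
  have cancel: "A * (x / (z * A)) = x / z" if "A \<noteq> 0" for A x z :: 'a
    using that by simp
  have "qcoef e (add_mset r lam) = (e * (1 - t ^ r) * (\<Prod>i\<in>#lam. e * (1 - t ^ i))) /
      (of_nat (zee lam) * (of_nat r * of_nat (Suc (count lam r))))"
    unfolding qcoef_def zee_add_mset of_nat_mult by simp
  then show ?thesis
    by (simp only: cancel[OF nz]) (simp add: qcoef_def)
qed

lemma qcoef_empty [simp]: "qcoef e {#} = 1"
  by (simp add: qcoef_def zee_def)

lemma homog_qz: "qz e n \<in> homog n"
  by (auto simp: homog_iff lookup_qz)

lemma valid_qz: "valid_sym (qz e n)"
  using homog_qz valid_homog by blast

lemma qz_neg [simp]: "n < 0 \<Longrightarrow> qz e n = 0"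
  by (simp add: qz_def)

lemma qz_0 [simp]: "qz e 0 = 1"
proof (rule poly_mapping_eqI)
  fix lam
  have "is_partition lam \<and> int (sum_mset lam) = 0 \<longleftrightarrow> lam = {#}"
    by (cases lam) auto
  then show "lookup (qz e 0) lam = lookup 1 lam"
    by (auto simp: lookup_qz lookup_one)
qed

text \<open>Differentiating the exponential in p_r multiplies it by e (1-t^r)/r z^r, which lowers
  the index by r.\<close>

lemma pderiv_qz:
  assumes "0 < r"
  shows "pderiv_sym r (qz e n) = scal (e * (1 - t ^ r) / of_nat r) (qz e (n - int r))"
proof (rule poly_mapping_eqI)
  fix lam
  show "lookup (pderiv_sym r (qz e n)) lam = lookup (scal (e * (1 - t ^ r) / of_nat r) (qz e (n - int r))) lam"
    using qcoef_add_mset[OF assms, of lam e] assms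
    by (auto simp: lookup_pderiv_sym lookup_qz field_simps simp del: of_nat_Suc)
qed

lemma sum_mset_eq_sum_count:
  fixes lam :: "nat multiset"
  assumes "finite A" "set_mset lam \<subseteq> A"
  shows "sum_mset lam = (\<Sum>r\<in>A. count lam r * r)"
  using assms(2)
proof (induction lam)
  case (add x lam)
  have "(\<Sum>r\<in>A. count (add_mset x lam) r * r) = (\<Sum>r\<in>A. (if r = x then x else 0) + count lam r * r)"
    by (rule sum.cong) auto
  also have "\<dots> = x + (\<Sum>r\<in>A. count lam r * r)"
    using add.prems assms(1) by (simp add: sum.distrib)
  finally show ?case using add by simp
qed simp

text \<open>The coefficient form of z d/dz applied to the exponential. At p_lam the summand r
  contributes the share \<open>count lam r * r\<close> of the degree n.\<close>

lemma qz_newton: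
  "scal (of_nat n) (qz e (int n)) = (\<Sum>r = 1..n. scal (e * (1 - t ^ r)) (pvar r * qz e (int n - int r)))"
proof (rule poly_mapping_eqI)
  fix lam
  have *: "e * (1 - t ^ r) * lookup (pvar r * qz e (int n - int r)) lam =
      of_nat (count lam r * r) * lookup (qz e (int n)) lam" if "r \<in> {1..n}" for r
  proof (cases "r \<in># lam")
    case True
    then obtain mu where "lam = add_mset r mu" by (metis insert_DiffM)
    then show ?thesis
      using qcoef_add_mset[of r mu e] that
      by (auto simp: lookup_psym_times lookup_qz mult_ac simp del: of_nat_Suc mult_Suc mult_Suc_right)
  next
    case False
    then have "count lam r = 0" by (simp add: not_in_iff)
    then show ?thesis using False by (simp add: lookup_psym_times)
  qed
  show "lookup (scal (of_nat n) (qz e (int n))) lam =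
    lookup (\<Sum>r = 1..n. scal (e * (1 - t ^ r)) (pvar r * qz e (int n - int r))) lam"
  proof (cases "is_partition lam \<and> int (sum_mset lam) = int n")
    case True
    have "r \<in> {1..n}" if "r \<in># lam" for r
    proof -
      have "r \<le> sum_mset lam" by (metis insert_DiffM[OF that] sum_mset.add_mset le_add1)
      then show ?thesis using that True by (auto simp: is_partition_def Suc_le_eq)
    qed
    then have sub: "set_mset lam \<subseteq> {1..n}" by blast
    have "n = sum_mset lam" using True by simp
    also have "\<dots> = (\<Sum>r = 1..n. count lam r * r)" using sub by (rule sum_mset_eq_sum_count[rotated]) simp
    finally have "of_nat n * lookup (qz e (int n)) lam = of_nat (\<Sum>r = 1..n. count lam r * r) * lookup (qz e (int n)) lam"
      by simp
    moreover have "lookup (\<Sum>r = 1..n. scal (e * (1 - t ^ r)) (pvar r * qz e (int n - int r))) lam =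
      (\<Sum>r = 1..n. of_nat (count lam r * r) * lookup (qz e (int n)) lam)"
      unfolding lookup_sum lookup_scal by (rule sum.cong[OF refl]) (rule *)
    ultimately show ?thesis by (simp add: sum_distrib_right)
  next
    case False
    then have "lookup (qz e (int n)) lam = 0" by (auto simp: lookup_qz)
    moreover from this have "lookup (\<Sum>r = 1..n. scal (e * (1 - t ^ r)) (pvar r * qz e (int n - int r))) lam = 0"
      unfolding lookup_sum lookup_scal using * by (intro sum.neutral) simp
    ultimately show ?thesis by simp
  qed
qed

text \<open>The exponentials for e and -e are inverse to each other. The offsets a and b and the
  arbitrary finite range F are what the sums over normally ordered coefficients require.\<close>

lemma qz_inverse:
  assumes "finite F" "{- a..b} \<subseteq> F"
  shows "(\<Sum>k\<in>F. qz (- e) (a + k) * qz e (b - k)) = (if a + b = 0 then 1 else 0)"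
proof -
  let ?s = "\<lambda>a b. \<Sum>k\<in>{-a..b}. qz (- e) (a + k) * qz e (b - k)"
  have out: "qz (- e) (a + k) * qz e (b - k) = 0" if "k \<notin> {- a..b}" for a b k
    using that by (cases "a + k < 0") auto
  have "(\<Sum>k\<in>F. qz (- e) (a + k) * qz e (b - k)) = ?s a b"
    using assms out by (intro sum.mono_neutral_right) blast+
  moreover have "?s a b - (if a + b = 0 then 1 else 0) = 0"
  proof (rule sym_eq_0_pderiv)
    show "valid_sym (?s a b - (if a + b = 0 then 1 else 0))"
      by (intro valid_sym_diff valid_sym_sum valid_sym_mult valid_qz) auto
  next
    have "?s a b \<in> homog (a + b)"
      by (intro homog_sum) (use homog_mult[OF homog_qz homog_qz, of "-e" "a + k" e "b - k" for k] in simp)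
    then have "lookup (?s a b) {#} = 0" if "a + b \<noteq> 0"
      using that unfolding homog_iff by (force dest: spec[of _ "{#}"])
    moreover have "?s a b = 1" if "a + b = 0"
    proof -
      have "{- a..b} = {b}" using that by auto
      then show ?thesis using that by (simp only: sum.insert_remove finite.emptyI) simp
    qed
    ultimately show "lookup (?s a b - (if a + b = 0 then 1 else 0)) {#} = 0"
      by (auto simp: lookup_minus)
  next
    fix r :: nat assume r: "0 < r"
    let ?x = "e * (1 - t ^ r) / of_nat r"
    \<comment> \<open>Lowering either of the two indices by r gives the same sum after a shift of k,
      and the two derivative terms carry opposite signs.\<close>
    have shift: "(\<Sum>k\<in>{-a..b}. qz (- e) (a + k - int r) * qz e (b - k)) =
      (\<Sum>k\<in>{-a..b}. qz (- e) (a + k) * qz e (b - k - int r))" (is "?L = ?R")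
    proof -
      have "?L = (\<Sum>k\<in>{int r - a..b}. qz (- e) (a + k - int r) * qz e (b - k))"
        by (rule sum.mono_neutral_right) auto
      also have "\<dots> = (\<Sum>k\<in>{- a..b - int r}. qz (- e) (a + k) * qz e (b - k - int r))"
        by (rule sum.reindex_bij_witness[of _ "\<lambda>k. k + int r" "\<lambda>k. k - int r"]) (auto simp: algebra_simps)
      also have "\<dots> = ?R"
        by (rule sum.mono_neutral_left) auto
      finally show ?thesis .
    qed
    have "pderiv_sym r (?s a b) = scal (- ?x) ?L + scal ?x ?R"
      by (simp add: pderiv_sym_sum pderiv_sym_mult valid_qz pderiv_qz r sum.distrib sum_subtractf sum_negf sym.scale_sum_right)
    then have "pderiv_sym r (?s a b) = 0"
      by (simp add: shift)
    then show "pderiv_sym r (?s a b - (if a + b = 0 then 1 else 0)) = 0" by (simp add: pderiv_sym_diff)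
  qed
  ultimately show ?thesis by simp
qed

end

section \<open>Translations p_n -> p_n - e u^n\<close>

text \<open>The substitution as a map into polynomials in u over the algebra itself;
  \<open>scal c 1\<close> embeds a scalar c. Its multiplicativity turns into the convolution rule
  \<open>transl_mult\<close>.\<close>

definition transl_poly :: "'a::field \<Rightarrow> 'a sym \<Rightarrow> 'a sym poly" where
  "transl_poly e f = (\<Sum>lam\<in>keys f. smult (scal (lookup f lam) 1) (\<Prod>i\<in>#lam. [:pvar i:] - monom (scal e 1) i))"

text \<open>The coefficient of $u^k$ in $f[X - e u]$, that is, in the image of $f$ under $p_n \mapsto p_n - e u^n$.\<close>

definition transl :: "'a::field \<Rightarrow> nat \<Rightarrow> 'a sym \<Rightarrow> 'a sym" where
  "transl e k f = coeff (transl_poly e f) k"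

lemma smult_sum_right: "smult c (sum f A) = (\<Sum>i\<in>A. smult c (f i))"
  by (induction A rule: infinite_finite_induct) (simp_all add: smult_add_right)

lemma transl_poly_superset:
  assumes "finite A" "keys f \<subseteq> A"
  shows "transl_poly e f = (\<Sum>lam\<in>A. smult (scal (lookup f lam) 1) (\<Prod>i\<in>#lam. [:pvar i:] - monom (scal e 1) i))"
  unfolding transl_poly_def
  by (rule sum.mono_neutral_left) (use assms in \<open>auto simp: in_keys_iff\<close>)

lemma transl_poly_psym: "transl_poly e (psym lam) = (\<Prod>i\<in>#lam. [:pvar i:] - monom (scal e 1) i)"
  by (subst transl_poly_superset[where A = "{lam}"]) (auto simp: psym_def)

lemma transl_poly_add: "transl_poly e (f + g) = transl_poly e f + transl_poly e g"
  using keys_add[of f g]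
  by (subst (1 2 3) transl_poly_superset[where A = "keys f \<union> keys g"])
    (auto simp: lookup_add sum.distrib smult_add_left sym.scale_left_distrib)

lemma transl_poly_scal: "transl_poly e (scal c f) = smult (scal c 1) (transl_poly e f)"
proof -
  have "keys (scal c f) \<subseteq> keys f" by (auto simp: in_keys_iff)
  then show ?thesis
    by (subst (1 2) transl_poly_superset[where A = "keys f"])
      (auto simp: smult_sum_right mult.commute)
qed

lemma transl_poly_0 [simp]: "transl_poly e 0 = 0"
  by (simp add: transl_poly_def)

lemma transl_poly_sum: "transl_poly e (sum g A) = (\<Sum>i\<in>A. transl_poly e (g i))"
  by (induction A rule: infinite_finite_induct) (auto simp: transl_poly_add)

lemma transl_poly_mult: "transl_poly e (f * g) = transl_poly e f * transl_poly e g"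
proof -
  let ?S = "\<lambda>f A. \<Sum>lam\<in>A. scal (lookup f lam) (psym lam)"
  have pp: "psym lam * psym mu = (psym (lam + mu) :: 'a sym)" for lam mu :: "nat multiset"
    by (simp add: psym_def mult_single)
  have "transl_poly e (?S f A * ?S g B) = transl_poly e (?S f A) * transl_poly e (?S g B)" for A B
    by (simp add: sum_product transl_poly_sum transl_poly_scal pp transl_poly_psym mult.commute)
  from this[of "keys f" "keys g"] show ?thesis by (simp only: sym_expand[symmetric])
qed

lemma transl_add: "transl e k (f + g) = transl e k f + transl e k g"
  by (simp add: transl_def transl_poly_add)

lemma transl_scal: "transl e k (scal c f) = scal c (transl e k f)"
  by (simp add: transl_def transl_poly_scal)

lemma transl_0 [simp]: "transl e k 0 = 0"
  by (simp add: transl_def)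

lemma transl_sum: "transl e k (sum g A) = (\<Sum>i\<in>A. transl e k (g i))"
  by (induction A rule: infinite_finite_induct) (auto simp: transl_add)

lemma transl_mult: "transl e k (f * g) = (\<Sum>i\<le>k. transl e i f * transl e (k - i) g)"
  by (simp add: transl_def transl_poly_mult coeff_mult)

lemma transl_1: "transl e k 1 = (if k = 0 then 1 else 0)"
  using transl_poly_psym[of e "{#}"] by (simp add: transl_def)

lemma transl_pvar_mult:
  "transl e k (pvar r * f) = pvar r * transl e k f - (if r \<le> k then scal e (transl e (k - r) f) else 0)"
  using transl_poly_psym[of e "{#r#}"]
  by (auto simp: transl_def transl_poly_mult left_diff_distrib coeff_monom_mult)

lemma transl_zero: "valid_sym f \<Longrightarrow> transl e 0 f = f"
  by (induction f rule: sym_valid_induct)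
    (simp_all add: transl_1 transl_pvar_mult transl_add transl_scal)

lemma transl_homog:
  assumes "f \<in> homog d"
  shows "transl e k f \<in> homog (d - int k)"
proof -
  have psym: "is_partition lam \<Longrightarrow> transl e k (psym lam) \<in> homog (int (sum_mset lam) - int k)" for lam k
  proof (induction lam arbitrary: k)
    case empty
    then show ?case by (simp add: transl_1)
  next
    case (add r lam)
    have "pvar r * transl e k (psym lam) \<in> homog (int r + (int (sum_mset lam) - int k))"
      using homog_psym[of "{#r#}"] add by (intro homog_mult) auto
    moreover have "transl e (k - r) (psym lam) \<in> homog (int r + (int (sum_mset lam) - int k))" if "r \<le> k"
      using add.IH[of "k - r"] add.prems that by (simp add: of_nat_diff algebra_simps)
    ultimately show ?case unfolding psym_add_mset[of r lam] transl_pvar_mult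
      by (intro homog_diff) (auto intro: homog_scal simp: algebra_simps)
  qed
  show ?thesis using assms
    by (induction f rule: homog_induct)
      (use psym in \<open>auto simp: transl_add transl_scal intro: homog_add homog_scal\<close>)
qed

lemma transl_eq_0: "f \<in> homog d \<Longrightarrow> d < int k \<Longrightarrow> transl e k f = 0"
  using transl_homog[of f d e k] homog_neg by fastforce

lemma valid_transl: "valid_sym f \<Longrightarrow> valid_sym (transl e k f)"
proof (induction f arbitrary: k rule: sym_valid_induct)
  case (mult r g)
  have "valid_sym (pvar r :: 'a sym)" using mult(1) by (auto simp: valid_sym_def psym_def)
  then show ?case unfolding transl_pvar_mult
    by (auto intro!: valid_sym_diff valid_sym_mult valid_sym_scal mult.IH)
qed (auto simp: transl_1 transl_add transl_scal intro: valid_sym_add valid_sym_scal)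

text \<open>Each p_r is shifted by a constant, which differentiation does not see.\<close>

lemma pderiv_transl:
  "valid_sym f \<Longrightarrow> pderiv_sym r (transl e k f) = transl e k (pderiv_sym r f)"
proof (induction f arbitrary: k rule: sym_valid_induct)
  case (mult s g)
  then show ?case
    by (auto simp: transl_pvar_mult pderiv_sym_diff pderiv_sym_pvar_mult pderiv_sym_scal transl_add)
qed (auto simp: transl_1 transl_add transl_scal pderiv_sym_add pderiv_sym_scal)

context hall_littlewood
begin

lemma hall_uminus_right: "hall t f (- g) = - hall t f g"
  using hall_scal_right[of f "- 1" g] by simp

text \<open>Taking a factor p_r out of f gives a derivative on the other side. Differentiating
  \<open>qz (- e)\<close> in p_r produces exactly the extra term -e u^r by which the translation
  shifts p_r.\<close>

lemma hall_transl:
  "valid_sym f \<Longrightarrow> hall t (transl e k f) g = hall t f (qz (- e) (int k) * g)"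
proof (induction f arbitrary: k g rule: sym_valid_induct)
  case one
  have *: "(\<Sum>q. lookup g q when {#} = a + q) = (lookup g {#} when a = {#})" for a
    by (cases "a = {#}") auto
  have "lookup (qz (- e) (int k) * g) {#} = lookup (qz (- e) (int k)) {#} * lookup g {#}"
    unfolding lookup_mult * mult_when by simp
  then show ?case
    by (cases "k = 0") (auto simp: transl_1 hall_1_left lookup_qz)
next
  case (mult r f)
  let ?x = "of_nat r / (1 - t ^ r)"
  have "hall t (transl e k (pvar r * f)) g = ?x * hall t f (qz (- e) (int k) * pderiv_sym r g)
    - e * hall t f (qz (- e) (int k - int r) * g)"
    using mult by (simp add: transl_pvar_mult hall_minus_left hall_pvar_mult of_nat_diff)
  also have "\<dots> = ?x * hall t f (pderiv_sym r (qz (- e) (int k) * g))"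
  proof -
    have alg: "n / y * A - e * B = n / y * (- e * y / n * B + A)" if "n \<noteq> 0" "y \<noteq> 0" for n y A B :: 'a
      using that by (simp add: field_simps)
    show ?thesis
      unfolding pderiv_sym_mult[OF valid_qz] pderiv_qz[OF mult(1)] hall_add_right scal_mult_left hall_scal_right
      using mult(1) t_power by (intro alg) auto
  qed
  finally show ?case by (simp add: hall_pvar_mult)
qed (simp_all add: transl_add transl_scal hall_add_left)

section \<open>Scalars from moving a translation past a q series\<close>

text \<open>The coefficient of u^k in exp(-x sum_r (1-t^r)/r u^r).\<close>

definition ccoef :: "'a \<Rightarrow> nat \<Rightarrow> 'a" where
  "ccoef x k = (\<Sum>lam\<in>partitions k. qcoef (- x) lam)"

lemma hall_qz: "hall t (qz d (int k)) (qz (- e) (int k)) = ccoef (e * d) k"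
proof -
  have "qcoef d lam * qcoef (- e) lam * pnorm lam = qcoef (- (e * d)) lam" if "lam \<in> partitions k" for lam
  proof -
    have "is_partition lam" using that by (simp add: partitions_def)
    then have "(\<Prod>i\<in>#lam. d * (1 - t ^ i)) * (\<Prod>i\<in>#lam. - e * (1 - t ^ i)) =
      (\<Prod>i\<in>#lam. - (e * d) * (1 - t ^ i)) * (\<Prod>i\<in>#lam. 1 - t ^ i)" and "(\<Prod>i\<in>#lam. 1 - t ^ i) \<noteq> 0"
      using t_power by (induction lam) (auto simp: algebra_simps)
    then show ?thesis using zee_nonzero[OF \<open>is_partition lam\<close>]
      by (simp add: qcoef_def pnorm_def field_simps)
  qed
  moreover have "keys (qz d (int k)) \<subseteq> partitions k"
    using homog_qz[of d "int k"] by (auto simp: homog_def partitions_def)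
  then have "hall t (qz d (int k)) (qz (- e) (int k)) =
      (\<Sum>lam\<in>partitions k. lookup (qz d (int k)) lam * lookup (qz (- e) (int k)) lam * pnorm lam)"
    by (intro hall_superset) auto
  moreover have "lookup (qz x (int k)) lam = qcoef x lam" if "lam \<in> partitions k" for x lam
    using that by (simp add: lookup_qz partitions_def)
  ultimately show ?thesis by (simp add: ccoef_def)
qed

text \<open>Shifting p_r inside the exponential splits off a scalar exponential. On coefficients,
  both sides have the same derivatives by induction on the index, and only the constant terms remain
  to be compared.\<close>

lemma transl_qz:
  "transl e k (qz d n) = scal (ccoef (e * d) k) (qz d (n - int k))"
proof (induction "nat n" arbitrary: n rule: less_induct)
  case less
  show ?case
  proof (cases "n < 0")
    case False
    have "transl e k (qz d n) - scal (ccoef (e * d) k) (qz d (n - int k)) = 0"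
    proof (rule sym_eq_0_pderiv)
      show "valid_sym (transl e k (qz d n) - scal (ccoef (e * d) k) (qz d (n - int k)))"
        by (intro valid_sym_diff valid_transl valid_sym_scal valid_qz)
    next
      \<comment> \<open>The constant term is the pairing with 1; adjunction turns it into a pairing
        of two q functions.\<close>
      have "lookup (transl e k (qz d n)) {#} = hall t (qz d n) (qz (- e) (int k))"
        using hall_transl[OF valid_qz, of e k d n 1] by (simp add: hall_1_left hall_commute)
      also have "\<dots> = (if n = int k then ccoef (e * d) k else 0)"
        using hall_qz[of d k e] hall_homog_orthogonal[OF homog_qz homog_qz, of n "int k" d "- e"] by auto
      finally show "lookup (transl e k (qz d n) - scal (ccoef (e * d) k) (qz d (n - int k))) {#} = 0"
        by (auto simp: lookup_minus lookup_qz)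
    next
      fix r :: nat assume r: "0 < r"
      have "transl e k (qz d (n - int r)) = scal (ccoef (e * d) k) (qz d (n - int r - int k))"
        by (cases "n < int r") (use r False in \<open>auto intro: less\<close>)
      then show "pderiv_sym r (transl e k (qz d n) - scal (ccoef (e * d) k) (qz d (n - int k))) = 0"
        using r by (simp add: pderiv_sym_diff pderiv_transl valid_qz pderiv_qz pderiv_sym_scal transl_scal algebra_simps)
    qed
    then show ?thesis by simp
  qed simp
qed

text \<open>The pairing of \<open>qz_newton\<close> with \<open>qz (- x)\<close>, in which each p_r
  becomes a derivative lowering the second index as well.\<close>

lemma ccoef_newton: "of_nat k * ccoef x k = - x * (\<Sum>r = 1..k. (1 - t ^ r) * ccoef x (k - r))"
proof -
  have "of_nat k * ccoef x k = hall t (scal (of_nat k) (qz 1 (int k))) (qz (- x) (int k))"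
    using hall_qz[of 1 k x] by simp
  also have "\<dots> = (\<Sum>r = 1..k. - x * ((1 - t ^ r) * ccoef x (k - r)))"
    unfolding qz_newton hall_sum_left
  proof (rule sum.cong[OF refl])
    fix r assume r: "r \<in> {1..k}"
    have "hall t (qz 1 (int k - int r)) (qz (- x) (int k - int r)) = ccoef x (k - r)"
      using hall_qz[of 1 "k - r" x] r by (simp add: of_nat_diff)
    then show "hall t (scal (1 * (1 - t ^ r)) (pvar r * qz 1 (int k - int r))) (qz (- x) (int k)) =
      - x * ((1 - t ^ r) * ccoef x (k - r))"
      using r t_power[of r] by (simp add: hall_pvar_mult pderiv_qz hall_uminus_right)
  qed
  finally show ?thesis by (simp add: sum_distrib_left sum_negf)
qed

lemma ccoef_0 [simp]: "ccoef x 0 = 1"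
proof -
  have "partitions 0 = {{#}}"
    by (auto simp: partitions_def is_partition_def) (metis bot_nat_0.not_eq_extremum multiset_nonemptyE)
  then show ?thesis by (simp add: ccoef_def)
qed

text \<open>These are the coefficients of (1 - u)/(1 - t u).\<close>

lemma ccoef_1: "0 < k \<Longrightarrow> ccoef 1 k = t ^ k - t ^ (k - 1)"
proof (induction k rule: less_induct)
  case (less k)
  then obtain m where k: "k = Suc m" using gr0_implies_Suc by blast
  have tele: "(\<Sum>r = 1..j. t ^ (Suc m - r) - t ^ (m - r)) = t ^ m - t ^ (m - j)" if "j \<le> m" for j
    using that
  proof (induction j)
    case (Suc j)
    then have "Suc m - Suc j = m - j" by simp
    then show ?case using Suc by (simp del: diff_Suc_Suc)
  qed simp
  \<comment> \<open>The term r = k is kept apart: it involves \<open>ccoef 1 0\<close>, which is 1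
    and does not fit the pattern.\<close>
  have "(\<Sum>r = 1..m. (1 - t ^ r) * ccoef 1 (k - r)) =
    (\<Sum>r = 1..m. (t ^ (Suc m - r) - t ^ (m - r)) + (t ^ m - t ^ Suc m))"
  proof (rule sum.cong[OF refl])
    fix r assume r: "r \<in> {1..m}"
    then have "ccoef 1 (k - r) = t ^ (Suc m - r) - t ^ (m - r)"
      using less.IH[of "k - r"] k by simp
    moreover have "t ^ r * t ^ (Suc m - r) = t ^ Suc m" "t ^ r * t ^ (m - r) = t ^ m"
      using r by (simp_all flip: power_add)
    ultimately show "(1 - t ^ r) * ccoef 1 (k - r) = (t ^ (Suc m - r) - t ^ (m - r)) + (t ^ m - t ^ Suc m)"
      by (simp only: left_diff_distrib right_diff_distrib mult_1_left) simp
  qed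
  also have "\<dots> = t ^ m - 1 + of_nat m * (t ^ m - t ^ Suc m)"
    by (simp only: sum.distrib tele[OF order_refl]) simp
  finally have "(\<Sum>r = 1..Suc m. (1 - t ^ r) * ccoef 1 (k - r)) = of_nat k * (t ^ m - t ^ Suc m)"
    by (subst sum.cl_ivl_Suc) (simp add: k algebra_simps del: sum.cl_ivl_Suc)
  then have "of_nat k * ccoef 1 k = of_nat k * (t ^ Suc m - t ^ m)"
    using ccoef_newton[of k 1] by (simp only: k) (simp add: right_diff_distrib)
  then show ?case using k by (simp del: of_nat_Suc)
qed

text \<open>These are the coefficients of (1 - t u)/(1 - u).\<close>

lemma ccoef_minus_1: "0 < k \<Longrightarrow> ccoef (- 1) k = 1 - t"
proof (induction k rule: less_induct)
  case (less k)
  then obtain m where k: "k = Suc m" using gr0_implies_Suc by blast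
  have geo: "(1 - t) * (\<Sum>r = 1..j. 1 - t ^ r) = (1 - t) * of_nat j - (t - t ^ Suc j)" for j
    by (induction j) (auto simp: algebra_simps)
  have "(\<Sum>r = 1..m. (1 - t ^ r) * ccoef (- 1) (k - r)) = (\<Sum>r = 1..m. (1 - t) * (1 - t ^ r))"
    by (rule sum.cong) (use less.IH k in auto)
  also have "\<dots> = (1 - t) * of_nat m - (t - t ^ Suc m)"
    by (simp only: sum_distrib_left[symmetric] geo)
  finally have "(\<Sum>r = 1..Suc m. (1 - t ^ r) * ccoef (- 1) (k - r)) = of_nat k * (1 - t)"
    by (subst sum.cl_ivl_Suc) (simp add: k algebra_simps del: sum.cl_ivl_Suc)
  then have "of_nat k * ccoef (- 1) k = of_nat k * (1 - t)"
    using ccoef_newton[of k "- 1"] by (simp only: k) simp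
  then show ?case using k by (simp del: of_nat_Suc)
qed

end

context hall_littlewood
begin

section \<open>Vertex operators\<close>

text \<open>The coefficient of $z^n$ in Jing's vertex operator
  $f \mapsto \exp(e \sum_r \frac{1-t^r}{r} p_r z^r) f[X - e/z]$.\<close>

definition vop :: "'a \<Rightarrow> int \<Rightarrow> 'a sym \<Rightarrow> 'a sym" where
  "vop e n f = (\<Sum>i\<le>degree (transl_poly e f). qz e (n + int i) * transl e i f)"

lemma vop_degree:
  assumes "degree (transl_poly e f) \<le> D"
  shows "vop e n f = (\<Sum>i\<le>D. qz e (n + int i) * transl e i f)"
  unfolding vop_def
  by (rule sum.mono_neutral_left) (use assms in \<open>auto simp: transl_def coeff_eq_0\<close>)

lemma vop_homog_eq:
  assumes "f \<in> homog d" "d \<le> int D"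
  shows "vop e n f = (\<Sum>i\<le>D. qz e (n + int i) * transl e i f)"
proof -
  have "vop e n f = (\<Sum>i\<le>max D (degree (transl_poly e f)). qz e (n + int i) * transl e i f)"
    by (rule vop_degree) simp
  also have "\<dots> = (\<Sum>i\<le>D. qz e (n + int i) * transl e i f)"
    by (rule sum.mono_neutral_right) (use assms transl_eq_0[OF assms(1)] in auto)
  finally show ?thesis .
qed

lemma vop_add: "vop e n (f + g) = vop e n f + vop e n g"
proof -
  define D where "D = max (degree (transl_poly e (f + g))) (max (degree (transl_poly e f)) (degree (transl_poly e g)))"
  have "vop e n h = (\<Sum>i\<le>D. qz e (n + int i) * transl e i h)" if "h \<in> {f + g, f, g}" for h
    by (rule vop_degree) (use that in \<open>auto simp: D_def\<close>)
  then show ?thesis by (simp add: transl_add distrib_left sum.distrib)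
qed

lemma vop_scal: "vop e n (scal c f) = scal c (vop e n f)"
proof -
  define D where "D = max (degree (transl_poly e (scal c f))) (degree (transl_poly e f))"
  have "vop e n h = (\<Sum>i\<le>D. qz e (n + int i) * transl e i h)" if "h \<in> {scal c f, f}" for h
    by (rule vop_degree) (use that in \<open>auto simp: D_def\<close>)
  then show ?thesis by (simp add: transl_scal sym.scale_sum_right)
qed

lemma vop_0 [simp]: "vop e n 0 = 0"
  by (simp add: vop_def)

lemma vop_homog: "f \<in> homog d \<Longrightarrow> vop e n f \<in> homog (n + d)"
  unfolding vop_def
proof (rule homog_sum)
  fix i assume "f \<in> homog d"
  from homog_mult[OF homog_qz transl_homog[OF this], of e "n + int i" e i]
  show "qz e (n + int i) * transl e i f \<in> homog (n + d)" by simp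
qed

text \<open>The adjoint of a product of a q function and a translation is again such a product, with
  the two roles exchanged and the sign reversed.\<close>

lemma hall_vop:
  assumes "f \<in> homog d" "g \<in> homog d'"
  shows "hall t (vop e (int n) f) g = hall t f (vop (- e) (- int n) g)"
proof -
  define D where "D = nat (max \<bar>d\<bar> \<bar>d'\<bar>)"
  have D: "d \<le> int D" "d' \<le> int (n + D)" by (auto simp: D_def)
  note valid = valid_homog[OF assms(1)] valid_homog[OF assms(2)]
  have "vop (- e) (- int n) g = (\<Sum>j\<le>n + D. qz (- e) (- int n + int j) * transl (- e) j g)"
    by (rule vop_homog_eq[OF assms(2) D(2)])
  \<comment> \<open>For j < n the index -n + j is negative, so only j = n + i with i >= 0
    contributes.\<close>
  also have "\<dots> = (\<Sum>j\<in>{0 + n..D + n}. qz (- e) (- int n + int j) * transl (- e) j g)"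
    by (rule sum.mono_neutral_right) auto
  also have "\<dots> = (\<Sum>i\<le>D. qz (- e) (int i) * transl (- e) (n + i) g)"
    unfolding sum.shift_bounds_cl_nat_ivl by (simp add: atMost_atLeast0 add.commute)
  finally have *: "hall t f (vop (- e) (- int n) g) = (\<Sum>i\<le>D. hall t f (qz (- e) (int i) * transl (- e) (n + i) g))"
    by (simp add: hall_sum_right)
  have "hall t (qz e (int n + int i) * transl e i f) g = hall t f (qz (- e) (int i) * transl (- e) (n + i) g)" for i
  proof -
    have "hall t (transl (- e) (n + i) g) (transl e i f) = hall t g (qz e (int n + int i) * transl e i f)"
      using hall_transl[OF valid(2), of "- e" "n + i"] by simp
    then show ?thesis
      using hall_transl[OF valid(1), of e i "transl (- e) (n + i) g"] by (metis hall_commute)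
  qed
  then show ?thesis
    by (simp add: vop_homog_eq[OF assms(1) D(1)] hall_sum_left *)
qed

lemma hall_eqI:
  assumes "valid_sym f" "valid_sym g" "\<And>h. valid_sym h \<Longrightarrow> hall t f h = hall t g h"
  shows "f = g"
  using hall_nondegenerate[of "f - g"] assms by (simp add: valid_sym_diff hall_minus_left)

lemma qz_inverse_nat: "(\<Sum>i\<le>m. qz (- e) (int (m - i)) * qz e (int i)) = (if m = 0 then 1 else 0)"
proof -
  have "(\<Sum>i\<le>m. qz (- e) (int (m - i)) * qz e (int i)) = (\<Sum>k\<in>int ` {..m}. qz e (0 + k) * qz (- e) (int m - k))"
    by (subst sum.reindex) (auto simp: of_nat_diff mult.commute intro!: sum.cong)
  also have "\<dots> = (if m = 0 then 1 else 0)"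
  proof -
    have "{- 0..int m} \<subseteq> int ` {..m}"
      by (auto simp: image_iff) (metis atMost_iff of_nat_le_iff zero_le_imp_eq_int)
    then show ?thesis using qz_inverse[of "int ` {..m}" 0 "int m" "- e"] by simp
  qed
  finally show ?thesis .
qed

text \<open>By adjunction both sides turn into multiplication by the same product of q
  functions.\<close>

lemma transl_commute:
  fixes f :: "'a sym"
  assumes "valid_sym f"
  shows "transl e i (transl d j f) = transl d j (transl e i f)"
  by (rule hall_eqI) (use assms in \<open>auto simp: valid_transl hall_transl mult.left_commute\<close>)

lemma transl_inverse:
  fixes f :: "'a sym"
  assumes "valid_sym f"
  shows "(\<Sum>i\<le>m. transl (- e) i (transl e (m - i) f)) = (if m = 0 then f else 0)"
proof (rule hall_eqI)
  fix h :: "'a sym" assume "valid_sym h"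
  have "hall t (\<Sum>i\<le>m. transl (- e) i (transl e (m - i) f)) h =
    hall t f ((\<Sum>i\<le>m. qz (- e) (int (m - i)) * qz e (int i)) * h)"
    using assms by (simp add: hall_sum_left hall_transl valid_transl sum_distrib_right hall_sum_right mult.assoc)
  then show "hall t (\<Sum>i\<le>m. transl (- e) i (transl e (m - i) f)) h = hall t (if m = 0 then f else 0) h"
    unfolding qz_inverse_nat by simp
qed (use assms in \<open>auto intro!: valid_sym_sum valid_transl\<close>)

section \<open>Composition of two vertex operators\<close>

text \<open>Coefficients of the normally ordered product of two vertex operators; $D$ is the degree of $f$.\<close>

definition nord :: "'a \<Rightarrow> 'a \<Rightarrow> nat \<Rightarrow> 'a sym \<Rightarrow> int \<Rightarrow> int \<Rightarrow> 'a sym" where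
  "nord e d D f a b = (\<Sum>i\<le>D. \<Sum>j\<le>D. qz e (a + int i) * qz d (b + int j) * transl e i (transl d j f))"

lemma nord_commute:
  assumes "valid_sym f"
  shows "nord e d D f a b = nord d e D f b a"
  unfolding nord_def
  by (subst sum.swap) (simp add: transl_commute[OF assms, of e _ d] mult.commute)

lemma nord_eq_0_left: "a < - int D \<Longrightarrow> nord e d D f a b = 0"
  unfolding nord_def by (intro sum.neutral) auto

lemma sum_triangle:
  fixes g :: "nat \<Rightarrow> nat \<Rightarrow> 'b::comm_monoid_add"
  shows "(\<Sum>i\<le>n. \<Sum>k\<le>i. g k (i - k)) = (\<Sum>k\<le>n. \<Sum>i\<le>n - k. g k i)"
proof -
  have "(\<Sum>i\<le>n. \<Sum>k\<le>i. g k (i - k)) = (\<Sum>(k, i)\<in>{(k, i). k + i \<le> n}. g k i)"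
    using sum.triangle_reindex_eq[of g n] by simp
  also have "{(k, i). k + i \<le> n} = (SIGMA k:{..n}. {..n - k})" by auto
  finally show ?thesis by (simp add: sum.Sigma)
qed

text \<open>Carrying the outer translation past the inner q function costs the scalar
  \<open>ccoef (e * d) k\<close> and moves k from the inner index to the outer one. After that all
  translations stand on the right, as in \<open>nord\<close>.\<close>

lemma vop_vop:
  assumes f: "f \<in> homog (int D)" and K: "r + int D \<le> int K"
  shows "vop e s (vop d r f) = (\<Sum>k\<le>K. scal (ccoef (e * d) k) (nord e d D f (s + int k) (r - int k)))"
proof -
  let ?T = "\<lambda>i j. transl e i (transl d j f)"
  let ?g = "\<lambda>j k i. scal (ccoef (e * d) k) (qz e (s + int k + int i) * qz d (r - int k + int j) * ?T i j)"
  have T0: "?T i j = 0" if "i > D" for i j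
    using transl_eq_0[OF transl_homog[OF f, of d j], of i e] that by simp
  have "vop e s (vop d r f) = (\<Sum>i\<le>K + D. qz e (s + int i) * transl e i (vop d r f))"
    by (rule vop_homog_eq[OF vop_homog[OF f]]) (use K in simp)
  also have "\<dots> = (\<Sum>i\<le>K + D. \<Sum>j\<le>D. \<Sum>k\<le>i. ?g j k (i - k))"
  proof (rule sum.cong[OF refl])
    fix i
    have "transl e i (vop d r f) = (\<Sum>j\<le>D. \<Sum>k\<le>i. scal (ccoef (e * d) k) (qz d (r + int j - int k)) * ?T (i - k) j)"
      by (simp add: vop_homog_eq[OF f order_refl] transl_sum transl_mult transl_qz)
    also have "qz e (s + int i) * \<dots> = (\<Sum>j\<le>D. \<Sum>k\<le>i. ?g j k (i - k))"
      unfolding sum_distrib_left by (intro sum.cong refl) (simp add: of_nat_diff algebra_simps)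
    finally show "qz e (s + int i) * transl e i (vop d r f) = (\<Sum>j\<le>D. \<Sum>k\<le>i. ?g j k (i - k))" .
  qed
  also have "\<dots> = (\<Sum>j\<le>D. \<Sum>k\<le>K + D. \<Sum>i\<le>K + D - k. ?g j k i)"
  proof -
    have "(\<Sum>i\<le>K + D. \<Sum>k\<le>i. ?g j k (i - k)) = (\<Sum>k\<le>K + D. \<Sum>i\<le>K + D - k. ?g j k i)" for j
      using sum_triangle[of "?g j" "K + D"] .
    then show ?thesis by (subst sum.swap[where B = "{..D}"]) (simp only:)
  qed
  \<comment> \<open>For k > K the index r - k + j is negative for every j up to D. In the next line,
    translations beyond the degree D vanish.\<close>
  also have "\<dots> = (\<Sum>j\<le>D. \<Sum>k\<le>K. \<Sum>i\<le>K + D - k. ?g j k i)"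
    by (intro sum.cong refl sum.mono_neutral_right) (use K in \<open>auto intro!: sum.neutral\<close>)
  also have "\<dots> = (\<Sum>j\<le>D. \<Sum>k\<le>K. \<Sum>i\<le>D. ?g j k i)"
    by (intro sum.cong refl sum.mono_neutral_right) (auto simp: T0)
  also have "\<dots> = (\<Sum>k\<le>K. \<Sum>i\<le>D. \<Sum>j\<le>D. ?g j k i)"
    by (subst sum.swap[where B = "{..K}"], rule sum.cong[OF refl], rule sum.swap)
  also have "\<dots> = (\<Sum>k\<le>K. scal (ccoef (e * d) k) (nord e d D f (s + int k) (r - int k)))"
    by (simp add: nord_def sym.scale_sum_right)
  finally show ?thesis .
qed

text \<open>The left-hand side multiplies the factor (1 - u)/(1 - t u) by 1 - t u. What remains is 1
  - u, that is, two normally ordered terms.\<close>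

lemma vop_exchange_aux:
  assumes f: "f \<in> homog (int D)"
  shows "vop 1 (s - 1) (vop 1 r f) - scal t (vop 1 s (vop 1 (r - 1) f)) =
    nord 1 1 D f (s - 1) r - nord 1 1 D f s (r - 1)"
proof -
  define K where "K = nat \<bar>r + int D\<bar>"
  let ?N = "\<lambda>k. nord 1 1 D f (s + int k) (r - 1 - int k)"
  have "vop 1 (s - 1) (vop 1 r f) =
      (\<Sum>k\<le>Suc K. scal (ccoef (1 * 1) k) (nord 1 1 D f (s - 1 + int k) (r - int k)))"
    by (rule vop_vop[OF f]) (simp add: K_def)
  also have "\<dots> = nord 1 1 D f (s - 1) r + (\<Sum>k\<le>K. scal (ccoef 1 (Suc k)) (?N k))"
    unfolding sum.atMost_Suc_shift by (simp add: algebra_simps)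
  finally have A: "vop 1 (s - 1) (vop 1 r f) =
    nord 1 1 D f (s - 1) r + (\<Sum>k\<le>K. scal (ccoef 1 (Suc k)) (?N k))" .
  have B: "vop 1 s (vop 1 (r - 1) f) = (\<Sum>k\<le>K. scal (ccoef (1 * 1) k) (?N k))"
    by (rule vop_vop[OF f]) (simp add: K_def)
  have "(\<Sum>k\<le>K. scal (ccoef 1 (Suc k)) (?N k)) - scal t (\<Sum>k\<le>K. scal (ccoef 1 k) (?N k)) =
    (\<Sum>k\<le>K. scal (ccoef 1 (Suc k) - t * ccoef 1 k) (?N k))"
    by (simp add: sym.scale_sum_right sum_subtractf sym.scale_left_diff_distrib)
  also have "\<dots> = (\<Sum>k\<le>K. if k = 0 then - ?N 0 else 0)"
  proof (rule sum.cong[OF refl])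
    fix k
    show "scal (ccoef 1 (Suc k) - t * ccoef 1 k) (?N k) = (if k = 0 then - ?N 0 else 0)"
      by (cases k) (simp_all add: ccoef_1 algebra_simps)
  qed
  finally show ?thesis using A B by simp
qed

text \<open>For equal signs the normally ordered coefficients are symmetric, so the right-hand side
  of \<open>vop_exchange_aux\<close> changes sign when s + 1 and r are interchanged.\<close>

lemma vop_exchange:
  assumes f: "f \<in> homog d"
  shows "vop 1 s (vop 1 r f) = scal t (vop 1 (s + 1) (vop 1 (r - 1) f))
    - vop 1 (r - 1) (vop 1 (s + 1) f) + scal t (vop 1 r (vop 1 s f))"
proof (cases "d < 0")
  case False
  then have f': "f \<in> homog (int (nat d))" using f by simp
  have "nord 1 1 (nat d) f s r - nord 1 1 (nat d) f (s + 1) (r - 1) =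
    - (nord 1 1 (nat d) f (r - 1) (s + 1) - nord 1 1 (nat d) f r s)"
    using nord_commute[OF valid_homog[OF f], of 1 1] by simp
  then have "vop 1 s (vop 1 r f) - scal t (vop 1 (s + 1) (vop 1 (r - 1) f)) =
    - (vop 1 (r - 1) (vop 1 (s + 1) f) - scal t (vop 1 r (vop 1 s f)))"
    using vop_exchange_aux[OF f', of "s + 1" r] vop_exchange_aux[OF f', of r "s + 1"] by simp
  moreover have *: "a - b = - (c - d) \<Longrightarrow> a = b - c + d" for a b c d :: "'a sym"
    by (simp add: algebra_simps)
  ultimately show ?thesis by (intro *)
qed (use homog_neg[OF f] in simp)

text \<open>Summing over j amounts to equating the two formal variables. The q functions of opposite
  sign then cancel, leaving i + l = n - m, and along this antidiagonal the two translations cancel.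
  The bounds make the interval contain all nonzero terms.\<close>

lemma sum_nord_inverse:
  assumes f: "f \<in> homog (int D)" and "lo \<le> n - int D" "m + int D \<le> hi"
  shows "(\<Sum>j\<in>{lo..hi}. nord (- 1) 1 D f (- n + j) (m - j)) = (if n = m then f else 0)"
proof -
  let ?T = "\<lambda>i l. transl (- 1) i (transl 1 l f)"
  have "(\<Sum>j\<in>{lo..hi}. nord (- 1) 1 D f (- n + j) (m - j)) =
    (\<Sum>i\<le>D. \<Sum>l\<le>D. \<Sum>j\<in>{lo..hi}. qz (- 1) ((- n + int i) + j) * qz 1 ((m + int l) - j) * ?T i l)"
    unfolding nord_def by (subst sum.swap, intro sum.cong refl, subst sum.swap) (simp add: algebra_simps)
  also have "\<dots> = (\<Sum>i\<le>D. \<Sum>l\<le>D. if int i + int l = n - m then ?T i l else 0)"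
  proof (intro sum.cong refl)
    fix i l assume "i \<in> {..D}" "l \<in> {..D}"
    then have "(\<Sum>j\<in>{lo..hi}. qz (- 1) ((- n + int i) + j) * qz 1 ((m + int l) - j)) =
      (if (- n + int i) + (m + int l) = 0 then 1 else 0)"
      using assms by (intro qz_inverse) auto
    then show "(\<Sum>j\<in>{lo..hi}. qz (- 1) ((- n + int i) + j) * qz 1 ((m + int l) - j) * ?T i l) =
      (if int i + int l = n - m then ?T i l else 0)"
      unfolding sum_distrib_right[symmetric] by auto
  qed
  also have "\<dots> = (if n = m then f else 0)"
  proof (cases "n < m")
    case True
    then show ?thesis by (auto intro!: sum.neutral)
  next
    case False
    define p where "p = nat (n - m)"
    define D' where "D' = max D p"
    have p: "int i + int l = n - m \<longleftrightarrow> i \<le> p \<and> l = p - i" for i l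
      using False by (auto simp: p_def)
    have T0: "?T i l = 0" if "i > D \<or> l > D" for i l
      using transl_eq_0[OF transl_homog[OF f, of 1 l], of i "- 1"] transl_eq_0[OF f, of l 1] that by auto
    \<comment> \<open>The larger square has room for the whole antidiagonal; the added translations
      exceed the degree of f.\<close>
    have "(\<Sum>i\<le>D. \<Sum>l\<le>D. if int i + int l = n - m then ?T i l else 0) =
      (\<Sum>i\<le>D'. \<Sum>l\<le>D. if int i + int l = n - m then ?T i l else 0)"
      by (rule sum.mono_neutral_left) (auto simp: D'_def T0 intro!: sum.neutral)
    also have "\<dots> = (\<Sum>i\<le>D'. \<Sum>l\<le>D'. if int i + int l = n - m then ?T i l else 0)"
      by (intro sum.cong refl sum.mono_neutral_left) (auto simp: D'_def T0)
    also have "\<dots> = (\<Sum>i\<le>D'. if i \<le> p then ?T i (p - i) else 0)"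
      unfolding p
    proof (intro sum.cong refl)
      fix i
      show "(\<Sum>l\<le>D'. if i \<le> p \<and> l = p - i then ?T i l else 0) = (if i \<le> p then ?T i (p - i) else 0)"
        by (cases "i \<le> p") (auto simp: D'_def)
    qed
    also have "\<dots> = (\<Sum>i\<le>p. if i \<le> p then ?T i (p - i) else 0)"
      by (rule sum.mono_neutral_right) (auto simp: D'_def)
    also have "\<dots> = (\<Sum>i\<le>p. ?T i (p - i))"
      by (rule sum.cong) auto
    also have "\<dots> = (if p = 0 then f else 0)"
      by (rule transl_inverse) (rule valid_homog[OF f])
    finally show ?thesis using False by (auto simp: p_def)
  qed
  finally show ?thesis .
qed

text \<open>Both orders of composition are combinations of the same coefficients $N_j$: one is
  $N_0 + (1-t) \sum_{j>0} N_j$, the other is $N_0 + (1-t) \sum_{j<0} N_j$, and $\sum_j N_j$ is known.\<close>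

lemma vop_adjoint_vop:
  assumes f: "f \<in> homog (int D)"
    and zero: "\<And>j. j < 0 \<Longrightarrow> vop 1 (m - j) (vop (- 1) (- n + j) f) = 0"
  shows "vop (- 1) (- n) (vop 1 m f) =
    scal t (vop 1 m (vop (- 1) (- n) f)) + scal (1 - t) (if n = m then f else 0)"
proof -
  define M where "M j = nord (- 1) 1 D f (- n + j) (m - j)" for j
  have other: "vop 1 (m - j) (vop (- 1) (- n + j) f) = (\<Sum>k\<le>K. scal (ccoef (- 1) k) (M (j - int k)))"
    if "- n + j + int D \<le> int K" for j K
  proof -
    have "vop 1 (m - j) (vop (- 1) (- n + j) f) = (\<Sum>k\<le>K. scal (ccoef (1 * - 1) k)
        (nord 1 (- 1) D f (m - j + int k) (- n + j - int k)))"
      by (rule vop_vop[OF f that])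
    also have "\<dots> = (\<Sum>k\<le>K. scal (ccoef (- 1) k) (M (j - int k)))"
      unfolding M_def using nord_commute[OF valid_homog[OF f], of 1 "- 1"]
      by (intro sum.cong refl) (simp add: algebra_simps)
    finally show ?thesis .
  qed
  \<comment> \<open>If all earlier coefficients vanish, only k = 0 survives in the composition taken
    in the other order.\<close>
  have below: "M j = vop 1 (m - j) (vop (- 1) (- n + j) f)" if "\<And>i. i < j \<Longrightarrow> M i = 0" for j
  proof -
    define K where "K = nat \<bar>- n + j + int D\<bar>"
    have "vop 1 (m - j) (vop (- 1) (- n + j) f) = (\<Sum>k\<le>K. scal (ccoef (- 1) k) (M (j - int k)))"
      by (rule other) (simp add: K_def)
    also have "\<dots> = (\<Sum>k\<le>K. if k = 0 then M j else 0)"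
      by (rule sum.cong) (auto simp: that)
    finally show ?thesis by simp
  qed
  \<comment> \<open>The coefficients vanish for j < n - D. Climbing from there, \<open>below\<close>
    and the hypothesis \<open>zero\<close> annihilate each further one with j < 0.\<close>
  have neg: "M j = 0" if "j < 0" for j
    using that
  proof (induction "nat (j + int D - n)" arbitrary: j rule: less_induct)
    case less
    show ?case
    proof (cases "j < n - int D")
      case True
      then show ?thesis unfolding M_def by (intro nord_eq_0_left) simp
    next
      case False
      have "M i = 0" if "i < j" for i
      proof (cases "i < n - int D")
        case True
        then show ?thesis unfolding M_def by (intro nord_eq_0_left) simp
      next
        case False
        then show ?thesis using less.prems that by (intro less.hyps) auto
      qed
      then show ?thesis using below zero less.prems by simp
    qed
  qed
  define K where "K = nat \<bar>m + int D\<bar>"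
  have "vop (- 1) (- n) (vop 1 m f) =
      (\<Sum>k\<le>K. scal (ccoef (- 1 * 1) k) (nord (- 1) 1 D f (- n + int k) (m - int k)))"
    by (rule vop_vop[OF f]) (simp add: K_def)
  \<comment> \<open>The coefficient 1 of the term k = 0 is split as (1 - t) + t, so that the first
    part joins the uniform sum.\<close>
  also have "\<dots> = (\<Sum>k\<le>K. scal (1 - t) (M (int k)) + (if k = 0 then scal t (M 0) else 0))"
    by (rule sum.cong) (auto simp: M_def ccoef_minus_1 sym.scale_left_diff_distrib)
  also have "\<dots> = scal t (M 0) + scal (1 - t) (\<Sum>k\<le>K. M (int k))"
    by (simp add: sum.distrib sym.scale_sum_right)
  also have "(\<Sum>k\<le>K. M (int k)) = (\<Sum>j\<in>int ` {..K}. M j)"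
    by (subst sum.reindex) auto
  also have "\<dots> = (\<Sum>j\<in>{min 0 (n - int D)..int K}. M j)"
  proof (rule sum.mono_neutral_left)
    show "\<forall>j\<in>{min 0 (n - int D)..int K} - int ` {..K}. M j = 0"
    proof
      fix j assume "j \<in> {min 0 (n - int D)..int K} - int ` {..K}"
      then have "j < 0" by (cases j) auto
      then show "M j = 0" by (rule neg)
    qed
    show "int ` {..K} \<subseteq> {min 0 (n - int D)..int K}" by auto
  qed simp
  also have "\<dots> = (if n = m then f else 0)"
    unfolding M_def by (rule sum_nord_inverse[OF f]) (auto simp: K_def)
  also have "M 0 = vop 1 m (vop (- 1) (- n) f)"
    using below[of 0] neg by simp
  finally show ?thesis .
qed

section \<open>Products of vertex operators\<close>

definition vseq :: "nat list \<Rightarrow> 'a sym" where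
  "vseq xs = foldr (\<lambda>n. vop 1 (int n)) xs 1"

lemma vseq_Nil [simp]: "vseq [] = 1" and vseq_Cons [simp]: "vseq (n # xs) = vop 1 (int n) (vseq xs)"
  by (simp_all add: vseq_def)

lemma vseq_homog: "vseq xs \<in> homog (int (sum_list xs))"
proof (induction xs)
  case (Cons n xs)
  then show ?case using vop_homog[OF Cons.IH, of 1 "int n"] by simp
qed simp

text \<open>The adjoint operator passes each factor with no diagonal term, since its index exceeds
  every part, and finally annihilates 1. The index n varies in the induction because the vanishing
  required by \<open>vop_adjoint_vop\<close> is the same claim for larger indices.\<close>

lemma vop_adjoint_vseq_above:
  assumes "sorted_wrt (\<ge>) xs" "\<And>x. x \<in> set xs \<Longrightarrow> int x < n" "0 < n"
  shows "vop (- 1) (- n) (vseq xs) = 0"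
  using assms
proof (induction xs arbitrary: n)
  case Nil
  then show ?case
    using vop_homog_eq[OF homog_1, of 0 "- 1" "- n"] by (simp add: transl_1)
next
  case (Cons m xs)
  have "vop (- 1) (- n + j) (vseq xs) = 0" if "j \<le> 0" for j
    using Cons.IH[of "n - j"] Cons.prems that by force
  then show ?case
    using vop_adjoint_vop[OF vseq_homog, of "int m" n xs] Cons.prems by force
qed

text \<open>The diagonal term contributes 1 - t, and passing the first operator contributes t times
  the factor for one copy of m fewer: (1 - t) + t (1 - t^c) = 1 - t^(c+1).\<close>

lemma vop_adjoint_vseq:
  assumes "sorted_wrt (\<ge>) (m # xs)" "0 < m"
  shows "vop (- 1) (- int m) (vseq (m # xs)) = scal (1 - t ^ Suc (count (mset xs) m)) (vseq xs)"
  using assms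
proof (induction xs)
  case Nil
  have *: "vop (- 1) (- int m + j) 1 = 0" if "j \<le> 0" for j
    using vop_adjoint_vseq_above[of "[]" "int m - j"] that Nil by simp
  moreover have "(1 :: 'a sym) \<in> homog (int 0)" by simp
  ultimately show ?case
    using vop_adjoint_vop[of 1 0 "int m" "int m"] *[of 0] by simp
next
  case (Cons l xs)
  have "vop (- 1) (- int m + j) (vseq (l # xs)) = 0" if "j < 0" for j
    using vop_adjoint_vseq_above[of "l # xs" "int m - j"] that Cons.prems by force
  then have eq: "vop (- 1) (- int m) (vseq (m # l # xs)) =
    scal t (vop 1 (int m) (vop (- 1) (- int m) (vseq (l # xs)))) + scal (1 - t) (vseq (l # xs))"
    using vop_adjoint_vop[OF vseq_homog, of "int m" "int m" "l # xs"] by simp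
  show ?case
  proof (cases "l = m")
    case True
    have "vop (- 1) (- int m) (vseq (m # xs)) = scal (1 - t ^ Suc (count (mset xs) m)) (vseq xs)"
      using Cons True by auto
    then show ?thesis unfolding eq using True
      by (simp add: vop_scal right_diff_distrib flip: sym.scale_left_distrib)
  next
    case False
    then have "vop (- 1) (- int m) (vseq (l # xs)) = 0"
      using Cons.prems by (intro vop_adjoint_vseq_above) force+
    moreover have "count (mset (l # xs)) m = 0"
      using False Cons.prems by (force simp: not_in_iff[symmetric])
    ultimately show ?thesis unfolding eq by simp
  qed
qed

text \<open>The larger of the two leading parts is moved across by adjunction. It annihilates the
  other side if the leading parts differ; otherwise both are removed at the cost of a nonzero
  factor.\<close>

lemma hall_vseq:
  assumes "sorted_wrt (\<ge>) xs" "sorted_wrt (\<ge>) ys" "0 \<notin> set xs" "0 \<notin> set ys"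
  shows "hall t (vseq xs) (vseq ys) \<noteq> 0 \<longleftrightarrow> xs = ys"
  using assms
proof (induction xs arbitrary: ys)
  case Nil
  show ?case
  proof (cases ys)
    case Nil
    then show ?thesis by (simp add: hall_1_left)
  next
    case (Cons b ys')
    then have "sum_list ys > 0" using Nil.prems by simp
    then show ?thesis using hall_homog_orthogonal[OF homog_1 vseq_homog, of ys] Cons by auto
  qed
next
  case (Cons a xs)
  show ?case
  proof (cases ys)
    case Nil
    then have "sum_list (a # xs) > 0" using Cons.prems by simp
    then show ?thesis using hall_homog_orthogonal[OF vseq_homog homog_1, of "a # xs"] Nil
      by (auto simp del: vseq_Cons)
  next
    case ys: (Cons b ys')
    have adj: "hall t (vseq (c # zs)) (vseq ws) = hall t (vseq zs) (vop (- 1) (- int c) (vseq ws))" for c zs ws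
      using hall_vop[OF vseq_homog vseq_homog, of 1 c zs ws] by simp
    consider "b < a" | "a < b" | "a = b" by linarith
    then show ?thesis
    proof cases
      case 1
      then have "vop (- 1) (- int a) (vseq ys) = 0"
        using Cons.prems ys by (intro vop_adjoint_vseq_above) force+
      then show ?thesis using 1 ys adj by (simp del: vseq_Cons)
    next
      case 2
      then have "vop (- 1) (- int b) (vseq (a # xs)) = 0"
        using Cons.prems ys by (intro vop_adjoint_vseq_above) force+
      then have "hall t (vseq ys) (vseq (a # xs)) = 0" using ys adj by (simp del: vseq_Cons)
      then show ?thesis using 2 ys by (simp add: hall_commute del: vseq_Cons)
    next
      case 3
      have "hall t (vseq (a # xs)) (vseq ys) = (1 - t ^ Suc (count (mset ys') b)) * hall t (vseq xs) (vseq ys')"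
        unfolding adj using vop_adjoint_vseq[of b ys'] Cons.prems ys 3 by (simp del: vseq_Cons power_Suc)
      moreover have "t ^ Suc (count (mset ys') b) \<noteq> 1" by (rule t_power) simp
      ultimately show ?thesis using Cons.IH[of ys'] Cons.prems ys 3 by (auto simp del: vseq_Cons power_Suc)
    qed
  qed
qed

end

section \<open>Dominance order\<close>

lemma mset_parts [simp]: "mset (parts lam) = lam"
  by (simp add: parts_def)

lemma set_parts [simp]: "set (parts lam) = set_mset lam"
  by (metis mset_parts set_mset_mset)

lemma sorted_parts: "sorted_wrt (\<ge>) (parts lam)"
  by (simp add: parts_def sorted_wrt_rev)

lemma parts_mset:
  assumes "sorted_wrt (\<ge>) xs"
  shows "parts (mset xs) = xs"
proof -
  have "sort xs = rev xs"
    by (rule properties_for_sort) (use assms in \<open>simp_all add: sorted_wrt_rev\<close>)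
  then show ?thesis by (simp add: parts_def)
qed

lemma parts_eq_iff: "parts lam = parts mu \<longleftrightarrow> lam = mu"
  by (metis mset_parts)

lemma parts_add_mset:
  assumes "\<And>x. x \<in># lam \<Longrightarrow> x \<le> n"
  shows "parts (add_mset n lam) = n # parts lam"
  using parts_mset[of "n # parts lam"] assms sorted_parts[of lam] by simp

lemma sum_list_parts [simp]: "sum_list (parts lam) = sum_mset lam"
  by (metis mset_parts sum_mset_sum_list)

lemma sum_part: "(\<Sum>i<k. part lam i) = sum_list (take k (parts lam))"
proof (induction k)
  case (Suc k)
  then show ?case by (cases "k < length (parts lam)") (auto simp: part_def take_Suc_conv_app_nth)
qed simp

text \<open>Any k parts bound the sum of the k largest from below. This avoids locating the raised
  and lowered parts after sorting.\<close>

lemma sum_submultiset_le: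
  fixes xs :: "nat list"
  assumes "sorted_wrt (\<ge>) xs" "N \<subseteq># mset xs" "size N \<le> k"
  shows "sum_mset N \<le> sum_list (take k xs)"
  using assms
proof (induction xs arbitrary: N k)
  case (Cons x xs)
  show ?case
  proof (cases "N = {#}")
    case False
    then obtain k' where k: "k = Suc k'" using Cons.prems(3) by (cases k) auto
    \<comment> \<open>The first entry x is taken out of N if it occurs there; otherwise any element
      of N will do, and it is at most x.\<close>
    have "\<exists>y N'. N = add_mset y N' \<and> y \<le> x \<and> N' \<subseteq># mset xs"
    proof (cases "x \<in># N")
      case True
      then obtain N' where "N = add_mset x N'" by (metis insert_DiffM)
      then show ?thesis using Cons.prems(2) by auto
    next
      case x: False
      obtain y where y: "y \<in># N" using False by blast
      then obtain N' where N': "N = add_mset y N'" by (metis insert_DiffM)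
      have "N \<subseteq># mset xs"
      proof (rule mset_subset_eqI)
        fix a
        show "count N a \<le> count (mset xs) a"
          using mset_subset_eq_count[OF Cons.prems(2), of a] x by (cases "a = x") (auto simp: not_in_iff)
      qed
      moreover from this have "y \<in> set xs" using y by (metis mset_subset_eqD set_mset_mset)
      then have "y \<le> x" using Cons.prems(1) by simp
      ultimately show ?thesis using N'
        by (metis subset_mset.order_trans mset_subset_eq_add_mset_cancel multi_self_add_other_not_self
            diff_subset_eq_self add_mset_remove_trivial)
    qed
    then obtain y N' where N': "N = add_mset y N'" "y \<le> x" "N' \<subseteq># mset xs" by blast
    then have "sum_mset N' \<le> sum_list (take k' xs)"
      using Cons k by (intro Cons.IH) auto
    then show ?thesis using N' k by simp
  qed simp
qed simp

lemma sum_take_list_all2: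
  fixes xs ys :: "nat list"
  assumes "list_all2 (\<le>) ys xs"
  shows "sum_list (take r xs) + sum_list ys \<le> sum_list (take r ys) + sum_list xs"
  using assms
proof (induction arbitrary: r rule: list_all2_induct)
  case (Cons y ys x xs)
  have "sum_list ys \<le> sum_list xs"
    using Cons.hyps(2) by (rule list_all2_induct) auto
  then show ?case using Cons.IH[of "r - 1"] Cons.hyps(1) by (cases r) auto
qed simp

lemma sum_list_filter_pos: "sum_list (filter ((<) 0) xs) = sum_list (xs :: nat list)"
  by (induction xs) auto

lemma dominated_refl: "dominated lam lam"
  by (simp add: dominated_def)

lemma dominated_trans: "dominated lam mu \<Longrightarrow> dominated mu nu \<Longrightarrow> dominated lam nu"
  unfolding dominated_def by (metis order_trans)

lemma dominated_antisym:
  assumes "is_partition lam" "is_partition mu" "dominated lam mu" "dominated mu lam"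
  shows "lam = mu"
proof -
  have s: "(\<Sum>i<k. part lam i) = (\<Sum>i<k. part mu i)" for k
    using assms unfolding dominated_def by (metis order_antisym)
  have p: "part lam i = part mu i" for i
    using s[of "Suc i"] s[of i] by simp
  have pos: "0 < part nu i \<longleftrightarrow> i < length (parts nu)" if "is_partition nu" for nu i
    using that nth_mem[of i "parts nu"] by (auto simp: part_def is_partition_def)
  have "length (parts lam) = length (parts mu)"
    using pos[OF assms(1)] pos[OF assms(2)] p by (metis linorder_neqE_nat order_less_irrefl)
  moreover from this have "parts lam ! i = parts mu ! i" if "i < length (parts lam)" for i
    using p[of i] that by (simp add: part_def)
  ultimately show ?thesis using nth_equalityI parts_eq_iff by blast
qed

text \<open>One application of a vertex operator takes k from the parts of \<open>mu\<close> and
  adds it to the new part n. The leading entries lose at most k in total, which the front entry n +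
  k makes up for.\<close>

lemma dominated_add_mset:
  assumes "dominated lam mu" "\<And>x. x \<in># lam \<Longrightarrow> x \<le> n"
    and ys: "list_all2 (\<le>) ys (parts mu)" "sum_list ys + k = sum_mset mu"
  shows "dominated (add_mset n lam) (mset (filter ((<) 0) ((n + k) # ys)))"
    (is "dominated ?lam ?mu")
  unfolding dominated_def
proof (intro conjI allI)
  have "sum_mset ?mu = sum_list (filter ((<) 0) ((n + k) # ys))" by (rule sum_mset_sum_list)
  then have *: "sum_mset ?mu = n + k + sum_list ys" unfolding sum_list_filter_pos by simp
  then show "sum_mset ?lam = sum_mset ?mu"
    using assms by (simp add: dominated_def)
  fix r
  show "(\<Sum>i<r. part ?lam i) \<le> (\<Sum>i<r. part ?mu i)"
  proof (cases r)
    case (Suc r')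
    \<comment> \<open>At most r parts of the new partition, not necessarily the largest
      ones.\<close>
    let ?N = "mset (filter ((<) 0) ((n + k) # take r' ys))"
    have "(\<Sum>i<r. part ?lam i) = n + (\<Sum>i<r'. part lam i)"
      unfolding sum_part Suc using parts_add_mset[of lam n] assms(2) by simp
    also have "\<dots> \<le> n + (\<Sum>i<r'. part mu i)"
      using assms(1) by (simp add: dominated_def)
    also have "\<dots> \<le> n + k + sum_list (take r' ys)"
      unfolding sum_part using sum_take_list_all2[OF ys(1), of r'] ys(2) by simp
    also have "\<dots> = sum_mset ?N"
      unfolding sum_mset_sum_list sum_list_filter_pos by simp
    also have "\<dots> \<le> sum_list (take r (parts ?mu))"
    proof (rule sum_submultiset_le)
      have "mset (take r' ys) \<subseteq># mset ys"
        by (metis append_take_drop_id mset_append mset_subset_eq_add_left)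
      then have "filter_mset ((<) 0) (mset (take r' ys)) \<subseteq># filter_mset ((<) 0) (mset ys)"
        by (rule multiset_filter_mono)
      then show "?N \<subseteq># mset (parts ?mu)" by simp
      have "length (filter ((<) 0) (take r' ys)) \<le> r'"
        using length_filter_le[of _ "take r' ys"] by (metis length_take min.bounded_iff)
      then show "size ?N \<le> r" unfolding size_mset using Suc by simp
    qed (rule sorted_parts)
    finally show ?thesis by (simp only: sum_part)
  qed simp
qed

section \<open>Triangularity\<close>

text \<open>With L the identity this is transitivity of spans; it is also applied to multiplications
  and vertex operators.\<close>

lemma span_map:
  fixes L :: "'a::field sym \<Rightarrow> 'a sym"
  assumes "f \<in> sym.span S" "\<And>x y. L (x + y) = L x + L y" "\<And>c x. L (scal c x) = scal c (L x)"
    and "\<And>s. s \<in> S \<Longrightarrow> L s \<in> sym.span S'"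
  shows "L f \<in> sym.span S'"
  using assms(1)
proof (rule sym.span_induct)
  have "L 0 = 0" using assms(3)[of 0 0] by simp
  then show "sym.subspace {f. L f \<in> sym.span S'}"
    by (auto simp: sym.subspace_def assms sym.span_zero intro: sym.span_add sym.span_scale)
qed (rule assms(4))

context hall_littlewood
begin

definition qmul :: "nat multiset \<Rightarrow> 'a sym" where
  "qmul lam = (\<Prod>i\<in>#lam. qz 1 (int i))"

lemma qmul_empty [simp]: "qmul {#} = 1"
  by (simp add: qmul_def)

lemma qmul_add_mset: "qmul (add_mset n lam) = qz 1 (int n) * qmul lam"
  by (simp add: qmul_def)

lemma qmul_filter_pos: "qmul (mset (filter ((<) 0) xs)) = qmul (mset xs)"
  by (induction xs) (auto simp: qmul_add_mset)

lemma qmul_homog: "qmul lam \<in> homog (int (sum_mset lam))"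
proof (induction lam)
  case (add n lam)
  then show ?case using homog_mult[OF homog_qz, of "qmul lam" _ 1 "int n"] by (simp add: qmul_add_mset)
qed simp

text \<open>The amount k is distributed over the factors, and each factor answers with a multiple of
  a q function of lower index.\<close>

lemma transl_qmul:
  "transl 1 k (qmul (mset xs)) \<in> sym.span {qmul (mset ys) | ys. list_all2 (\<le>) ys xs \<and> sum_list ys + k = sum_list xs}"
proof (induction xs arbitrary: k)
  case Nil
  show ?case by (auto simp: transl_1 intro: sym.span_base sym.span_zero)
next
  case (Cons x xs)
  let ?S = "\<lambda>k xs. {qmul (mset ys) | ys. list_all2 (\<le>) ys xs \<and> sum_list ys + k = sum_list xs}"
  have "qz 1 (int x - int i) * transl 1 (k - i) (qmul (mset xs)) \<in> sym.span (?S k (x # xs))" if "i \<le> k" for i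
  proof (cases "i \<le> x")
    case True
    show ?thesis
    proof (rule span_map[OF Cons.IH[of "k - i"]])
      fix s assume "s \<in> ?S (k - i) xs"
      then obtain ys where ys: "s = qmul (mset ys)" "list_all2 (\<le>) ys xs" "sum_list ys + (k - i) = sum_list xs"
        by blast
      have "qz 1 (int x - int i) * s = qmul (mset ((x - i) # ys))"
        using True by (simp add: ys qmul_add_mset of_nat_diff)
      moreover have "list_all2 (\<le>) ((x - i) # ys) (x # xs) \<and> sum_list ((x - i) # ys) + k = sum_list (x # xs)"
        using ys True \<open>i \<le> k\<close> by simp
      ultimately show "qz 1 (int x - int i) * s \<in> sym.span (?S k (x # xs))"
        by (intro sym.span_base) blast
    qed (simp_all add: distrib_left)
  qed (simp add: sym.span_zero)
  moreover have "transl 1 k (qmul (mset (x # xs))) =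
    (\<Sum>i\<le>k. scal (ccoef 1 i) (qz 1 (int x - int i) * transl 1 (k - i) (qmul (mset xs))))"
    by (simp add: qmul_add_mset transl_mult transl_qz)
  ultimately show ?case
    by (simp only:) (intro sym.span_sum sym.span_scale, simp)
qed

lemma vop_qmul:
  "vop 1 (int n) (qmul (mset xs)) - qmul (add_mset n (mset xs)) \<in>
    sym.span {qmul (mset ((n + k) # ys)) | k ys. 0 < k \<and> list_all2 (\<le>) ys xs \<and> sum_list ys + k = sum_list xs}"
    (is "_ \<in> sym.span ?S")
proof -
  let ?Q = "qmul (mset xs)" and ?D = "sum_list xs"
  have Q: "?Q \<in> homog (int ?D)" using qmul_homog[of "mset xs"] by (simp add: sum_mset_sum_list)
  have "vop 1 (int n) ?Q = (\<Sum>i\<le>?D. qz 1 (int n + int i) * transl 1 i ?Q)"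
    by (rule vop_homog_eq[OF Q order_refl])
  also have "\<dots> = qz 1 (int n) * ?Q + (\<Sum>i = 1..?D. qz 1 (int n + int i) * transl 1 i ?Q)"
    by (simp add: atMost_atLeast0 sum.atLeast_Suc_atMost transl_zero valid_homog[OF Q])
  finally have "vop 1 (int n) ?Q - qmul (add_mset n (mset xs)) =
    (\<Sum>i = 1..?D. qz 1 (int n + int i) * transl 1 i ?Q)" by (simp add: qmul_add_mset)
  also have "\<dots> \<in> sym.span ?S"
  proof (rule sym.span_sum)
    fix i assume i: "i \<in> {1..?D}"
    show "qz 1 (int n + int i) * transl 1 i ?Q \<in> sym.span ?S"
    proof (rule span_map[OF transl_qmul])
      fix s assume "s \<in> {qmul (mset ys) | ys. list_all2 (\<le>) ys xs \<and> sum_list ys + i = sum_list xs}"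
      then obtain ys where ys: "s = qmul (mset ys)" "list_all2 (\<le>) ys xs" "sum_list ys + i = sum_list xs"
        by blast
      then have "qz 1 (int n + int i) * s = qmul (mset ((n + i) # ys))" by (simp add: qmul_add_mset)
      then show "qz 1 (int n + int i) * s \<in> sym.span ?S"
        using ys i by (intro sym.span_base) fastforce
    qed (simp_all add: distrib_left)
  qed
  finally show ?thesis .
qed

definition qup :: "nat multiset \<Rightarrow> 'a sym set" where
  "qup lam = {qmul mu | mu. is_partition mu \<and> dominated lam mu \<and> mu \<noteq> lam}"

lemma vop_qmul_qup:
  assumes mu: "is_partition mu" "dominated lam mu" and n: "0 < n" "\<And>x. x \<in># lam \<Longrightarrow> x \<le> n"
  shows "vop 1 (int n) (qmul mu) - qmul (add_mset n mu) \<in> sym.span (qup (add_mset n lam))"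
proof -
  have "vop 1 (int n) (qmul (mset (parts mu))) - qmul (add_mset n (mset (parts mu))) \<in>
    sym.span {qmul (mset ((n + k) # ys)) | k ys. 0 < k \<and> list_all2 (\<le>) ys (parts mu) \<and> sum_list ys + k = sum_list (parts mu)}"
    by (rule vop_qmul)
  moreover have "{qmul (mset ((n + k) # ys)) | k ys. 0 < k \<and> list_all2 (\<le>) ys (parts mu) \<and> sum_list ys + k = sum_list (parts mu)}
    \<subseteq> qup (add_mset n lam)"
  proof clarsimp
    fix k ys assume k: "0 < k" "list_all2 (\<le>) ys (parts mu)" "sum_list ys + k = sum_mset mu"
    let ?nu = "mset (filter ((<) 0) ((n + k) # ys))"
    have "dominated (add_mset n lam) ?nu" by (rule dominated_add_mset[OF mu(2) n(2) k(2,3)])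
    moreover have "is_partition ?nu" by (auto simp: is_partition_def)
    \<comment> \<open>The part n + k exceeds every part of \<open>add_mset n lam\<close>, so the
      dominance is strict.\<close>
    moreover have "n + k \<in># ?nu" using n by simp
    then have "?nu \<noteq> add_mset n lam" using n k by (metis add_mset_remove_trivial insert_noteq_member
        less_add_same_cancel1 not_less order_less_irrefl union_single_eq_member insert_iff set_mset_add_mset_insert)
    moreover have "qmul (add_mset (n + k) (mset ys)) = qmul ?nu"
      unfolding qmul_filter_pos by simp
    ultimately show "qmul (add_mset (n + k) (mset ys)) \<in> qup (add_mset n lam)"
      unfolding qup_def by blast
  qed
  ultimately show ?thesis using sym.span_mono by (metis (no_types, lifting) mset_parts subsetD)
qed

text \<open>New terms arise from the leading product and from the corrections already present. The
  former are strictly higher by \<open>vop_qmul_qup\<close>; the latter stay strictly higher because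
  inserting n preserves dominance.\<close>

lemma vseq_triangular:
  assumes "sorted_wrt (\<ge>) xs" "0 \<notin> set xs"
  shows "vseq xs - qmul (mset xs) \<in> sym.span (qup (mset xs))"
  using assms
proof (induction xs)
  case Nil
  then show ?case by (simp add: sym.span_zero)
next
  case (Cons n xs)
  let ?U = "vseq xs - qmul (mset xs)"
  have n: "0 < n" "\<And>x. x \<in># mset xs \<Longrightarrow> x \<le> n" using Cons.prems by auto
  have "vseq (n # xs) = vop 1 (int n) (?U + qmul (mset xs))" by simp
  then have "vseq (n # xs) - qmul (mset (n # xs)) =
    vop 1 (int n) ?U + (vop 1 (int n) (qmul (mset xs)) - qmul (add_mset n (mset xs)))"
    unfolding vop_add by simp
  moreover have "is_partition (mset xs)" using Cons.prems by (auto simp: is_partition_def intro!: gr0I)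
  then have "vop 1 (int n) (qmul (mset xs)) - qmul (add_mset n (mset xs)) \<in> sym.span (qup (add_mset n (mset xs)))"
    by (rule vop_qmul_qup[OF _ dominated_refl n])
  moreover have "vop 1 (int n) ?U \<in> sym.span (qup (add_mset n (mset xs)))"
  proof (rule span_map[OF Cons.IH])
    fix s assume "s \<in> qup (mset xs)"
    then obtain mu where mu: "s = qmul mu" "is_partition mu" "dominated (mset xs) mu" "mu \<noteq> mset xs"
      by (auto simp: qup_def)
    have "dominated (add_mset n (mset xs)) (mset (filter ((<) 0) ((n + 0) # parts mu)))"
      by (rule dominated_add_mset[OF mu(3) n(2)]) (auto simp: list_all2_refl)
    moreover have "mset (filter ((<) 0) ((n + 0) # parts mu)) = add_mset n mu"
    proof -
      have "filter ((<) 0) (parts mu) = parts mu" using mu(2) by (auto simp: filter_id_conv is_partition_def)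
      then show ?thesis using n by simp
    qed
    ultimately have "qmul (add_mset n mu) \<in> qup (add_mset n (mset xs))"
      using mu n by (auto simp: qup_def)
    then have "qmul (add_mset n mu) + (vop 1 (int n) s - qmul (add_mset n mu)) \<in> sym.span (qup (add_mset n (mset xs)))"
      unfolding mu(1) by (intro sym.span_add vop_qmul_qup mu n) (auto intro: sym.span_base)
    then show "vop 1 (int n) s \<in> sym.span (qup (add_mset n (mset xs)))" by simp
  qed (use Cons.prems in \<open>auto simp: vop_add vop_scal\<close>)
  ultimately show ?case by (metis mset.simps(2) sym.span_add)
qed

definition vQ :: "nat multiset \<Rightarrow> 'a sym" where
  "vQ lam = vseq (parts lam)"

lemma vQ_homog: "vQ lam \<in> homog (int (sum_mset lam))"
  using vseq_homog[of "parts lam"] by (simp add: vQ_def)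

lemma valid_vQ: "valid_sym (vQ lam)"
  by (rule valid_homog[OF vQ_homog])

lemma hall_vQ:
  "is_partition lam \<Longrightarrow> is_partition mu \<Longrightarrow> hall t (vQ lam) (vQ mu) \<noteq> 0 \<longleftrightarrow> lam = mu"
  unfolding vQ_def by (subst hall_vseq) (auto simp: sorted_parts is_partition_def parts_eq_iff)

lemma vQ_triangular: "is_partition lam \<Longrightarrow> vQ lam - qmul lam \<in> sym.span (qup lam)"
  using vseq_triangular[of "parts lam"] by (auto simp: vQ_def sorted_parts is_partition_def)

lemma hall_span_eq_0:
  assumes "g \<in> sym.span S" "\<And>s. s \<in> S \<Longrightarrow> hall t f s = 0"
  shows "hall t f g = 0"
  using assms(1)
  by (rule sym.span_induct) (auto simp: sym.subspace_def hall_add_right assms(2))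

text \<open>This inverts the unitriangular relation: \<open>qmul nu\<close> is \<open>vQ nu\<close>
  plus terms strictly above, and the number of partitions dominating \<open>nu\<close>
  drops.\<close>

lemma hall_qmul_eq_0:
  assumes "is_partition nu"
    and "\<And>mu. is_partition mu \<Longrightarrow> dominated nu mu \<Longrightarrow> hall t f (vQ mu) = 0"
  shows "hall t f (qmul nu) = 0"
  using assms
proof (induction "card {mu \<in> partitions (sum_mset nu). dominated nu mu}" arbitrary: nu rule: less_induct)
  case less
  have "hall t f (vQ nu - qmul nu) = 0"
  proof (rule hall_span_eq_0[OF vQ_triangular])
    fix s assume "s \<in> qup nu"
    then obtain mu where mu: "s = qmul mu" "is_partition mu" "dominated nu mu" "mu \<noteq> nu"
      by (auto simp: qup_def)
    have eq: "sum_mset nu = sum_mset mu" using mu(3) by (simp add: dominated_def)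
    have "\<not> dominated mu nu" using mu dominated_antisym less.prems(1) by blast
    moreover have "nu \<in> partitions (sum_mset nu)" using less.prems(1) by (simp add: partitions_def)
    ultimately have "{rho \<in> partitions (sum_mset mu). dominated mu rho} \<subset> {rho \<in> partitions (sum_mset nu). dominated nu rho}"
      using mu(3) dominated_trans dominated_refl unfolding eq by blast
    then have "card {rho \<in> partitions (sum_mset mu). dominated mu rho} < card {rho \<in> partitions (sum_mset nu). dominated nu rho}"
      by (rule psubset_card_mono[rotated]) simp
    then show "hall t f s = 0"
      unfolding mu(1) using less.prems(2) mu dominated_trans by (intro less.hyps) blast+
  qed (rule less.prems(1))
  moreover have "hall t f (vQ nu) = 0" using less.prems dominated_refl by blast
  ultimately show ?case by (simp add: hall_minus_right)
qed

lemma hall_vQ_qmul: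
  assumes "is_partition lam" "is_partition nu" "\<not> dominated nu lam"
  shows "hall t (vQ lam) (qmul nu) = 0"
  by (rule hall_qmul_eq_0[OF assms(2)]) (use assms hall_vQ in blast)

lemma hall_vQ_qmul_self:
  assumes "is_partition lam"
  shows "hall t (vQ lam) (qmul lam) = hall t (vQ lam) (vQ lam)"
proof -
  have "hall t (vQ lam) (vQ lam - qmul lam) = 0"
    by (rule hall_span_eq_0[OF vQ_triangular[OF assms]])
      (use assms dominated_antisym in \<open>auto simp: qup_def intro!: hall_vQ_qmul\<close>)
  then show ?thesis by (simp add: hall_minus_right)
qed

lemma qmul_add: "qmul (lam + mu) = qmul lam * qmul mu"
  by (simp add: qmul_def)

text \<open>Newton's recursion can be solved for p_n because 1 - t^n is nonzero, and the span is
  closed under products.\<close>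

lemma psym_in_span_qmul:
  assumes "is_partition lam"
  shows "psym lam \<in> sym.span {qmul mu | mu. is_partition mu}"
proof -
  let ?Q = "sym.span {qmul mu | mu. is_partition mu}"
  have mult: "f * g \<in> ?Q" if f: "f \<in> ?Q" and g: "g \<in> ?Q" for f g
  proof (rule span_map[OF g])
    fix s assume "s \<in> {qmul mu | mu. is_partition mu}"
    then obtain mu where mu: "s = qmul mu" "is_partition mu" by blast
    have "s * f \<in> ?Q"
    proof (rule span_map[OF f])
      fix s' assume "s' \<in> {qmul mu | mu. is_partition mu}"
      then obtain nu where nu: "s' = qmul nu" "is_partition nu" by blast
      then have "s * s' = qmul (mu + nu)" "is_partition (mu + nu)" using mu by (simp_all add: qmul_add)
      then show "s * s' \<in> ?Q" by (intro sym.span_base) blast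
    qed (simp_all add: distrib_left)
    then show "f * s \<in> ?Q" by (simp add: mult.commute)
  qed (simp_all add: distrib_left)
  have "qmul {#} \<in> ?Q" using is_partition_empty by (intro sym.span_base) blast
  then have one: "1 \<in> ?Q" by simp
  have q: "qz 1 (int n) \<in> ?Q" for n
  proof (cases "n = 0")
    case False
    then have "qz 1 (int n) = qmul {#n#}" "is_partition {#n#}" by (simp_all add: qmul_def)
    then show ?thesis by (intro sym.span_base) blast
  qed (use one in simp)
  have p: "pvar n \<in> ?Q" if "0 < n" for n
    using that
  proof (induction n rule: less_induct)
    case (less n)
    \<comment> \<open>The summand r = n of the recursion is (1 - t^n) p_n, since the q function of
      index 0 is 1.\<close>
    have "scal (1 - t ^ n) (pvar n) = scal (of_nat n) (qz 1 (int n))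
      - (\<Sum>r = 1..n - 1. scal (1 - t ^ r) (pvar r * qz 1 (int n - int r)))"
    proof -
      have "{1..n} = insert n {1..n - 1}" using less.prems by auto
      then show ?thesis using less.prems by (simp add: qz_newton)
    qed
    also have "\<dots> \<in> ?Q"
    proof (intro sym.span_diff sym.span_sum sym.span_scale q mult)
      fix r assume r: "r \<in> {1..n - 1}"
      then have "r < n" "0 < r" using less.prems by auto
      then show "pvar r \<in> ?Q" by (intro less.IH)
      show "qz 1 (int n - int r) \<in> ?Q" using q[of "n - r"] \<open>r < n\<close> by (simp add: of_nat_diff)
    qed
    finally have "scal (inverse (1 - t ^ n)) (scal (1 - t ^ n) (pvar n)) \<in> ?Q"
      by (rule sym.span_scale)
    then show ?case using less.prems t_power[of n] by simp
  qed
  show ?thesis using assms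
  proof (induction lam)
    case (add r lam)
    then show ?case unfolding psym_add_mset[of r lam] by (intro mult p) auto
  qed (use one in simp)
qed

lemma sym_eq_0_hall_vQ:
  assumes "valid_sym f" "\<And>mu. is_partition mu \<Longrightarrow> hall t f (vQ mu) = 0"
  shows "f = 0"
proof (rule hall_nondegenerate[OF assms(1)])
  fix g :: "'a sym" assume "valid_sym g"
  have "hall t f (psym lam) = 0" if "is_partition lam" for lam
    by (rule hall_span_eq_0[OF psym_in_span_qmul[OF that]]) (use assms hall_qmul_eq_0 in blast)
  then have "hall t f (\<Sum>lam\<in>keys g. scal (lookup g lam) (psym lam)) = 0"
    using \<open>valid_sym g\<close> by (auto simp: hall_sum_right valid_sym_def intro!: sum.neutral)
  then show "hall t f g = 0" by (simp only: sym_expand[symmetric])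
qed

end

section \<open>Monomial coefficients\<close>

text \<open>The functions counted by \<open>pcoeff\<close>, written as lists. Since \<open>a\<close>
  is an arbitrary function, the first part can be split off by lowering one value of
  \<open>a\<close>.\<close>

definition assignments :: "nat list \<Rightarrow> (nat \<Rightarrow> nat) \<Rightarrow> nat list set" where
  "assignments xs a = {js. length js = length xs \<and>
     (\<forall>j. (\<Sum>i<length xs. if js ! i = j then xs ! i else 0) = a j)}"

lemma assignments_Cons:
  assumes "x \<noteq> 0" "\<And>j. j \<notin> J \<Longrightarrow> a j = 0"
  shows "assignments (x # xs) a = (\<Union>j\<in>{j \<in> J. x \<le> a j}. (#) j ` assignments xs (a(j := a j - x)))"
proof -
  have split: "(\<Sum>i<length (x # xs). if (j # js) ! i = l then (x # xs) ! i else 0) =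
      (if j = l then x else 0) + (\<Sum>i<length xs. if js ! i = l then xs ! i else 0)" for j js l
    by (simp only: length_Cons sum.lessThan_Suc_shift nth_Cons_0 nth_Cons_Suc)
  show ?thesis
  proof (intro equalityI subsetI)
    fix ks assume ks: "ks \<in> assignments (x # xs) a"
    then obtain j js where j: "ks = j # js" by (cases ks) (auto simp: assignments_def)
    have eq: "(if j = l then x else 0) + (\<Sum>i<length xs. if js ! i = l then xs ! i else 0) = a l" for l
      using ks split[of j js l] by (auto simp: assignments_def j)
    then have x: "x \<le> a j" using eq[of j] by simp
    moreover have "j \<in> J" using x assms by fastforce
    moreover have "js \<in> assignments xs (a(j := a j - x))"
      unfolding assignments_def
    proof (intro CollectI conjI allI)
      fix l show "(\<Sum>i<length xs. if js ! i = l then xs ! i else 0) = (a(j := a j - x)) l"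
        using eq[of l] by (cases "j = l") auto
    qed (use ks j in \<open>simp add: assignments_def\<close>)
    ultimately show "ks \<in> (\<Union>j\<in>{j \<in> J. x \<le> a j}. (#) j ` assignments xs (a(j := a j - x)))"
      using j by blast
  next
    fix ks assume "ks \<in> (\<Union>j\<in>{j \<in> J. x \<le> a j}. (#) j ` assignments xs (a(j := a j - x)))"
    then obtain j js where j: "ks = j # js" "x \<le> a j" "js \<in> assignments xs (a(j := a j - x))" by blast
    have "(\<Sum>i<length (x # xs). if (j # js) ! i = l then (x # xs) ! i else 0) = a l" for l
      unfolding split using j by (cases "j = l") (auto simp: assignments_def)
    then show "ks \<in> assignments (x # xs) a" using j(1,3) by (auto simp: assignments_def)
  qed
qed

text \<open>Positive parts can only be sent to indices with nonzero exponent, which is the codomain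
  prescribed in \<open>pcoeff\<close>.\<close>

lemma pcoeff_eq_card_assignments:
  assumes "is_partition lam"
  shows "pcoeff lam alpha = card (assignments (parts lam) (lookup alpha))"
proof -
  let ?xs = "parts lam"
  let ?n = "length ?xs"
  let ?G = "{g \<in> {0..<?n} \<rightarrow>\<^sub>E keys alpha.
      \<forall>j. (\<Sum>i \<in> {i. i < ?n \<and> g i = j}. ?xs ! i) = lookup alpha j}"
  have conv: "(\<Sum>i \<in> {i. i < ?n \<and> g i = j}. ?xs ! i) = (\<Sum>i<?n. if g i = j then ?xs ! i else 0)" for g :: "nat \<Rightarrow> nat" and j
    by (simp add: sum.inter_filter[symmetric] lessThan_def)
  have "bij_betw (\<lambda>g. map g [0..<?n]) ?G (assignments ?xs (lookup alpha))"
  proof (rule bij_betw_byWitness[where f' = "\<lambda>js. restrict (\<lambda>i. js ! i) {0..<?n}"])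
    show "\<forall>g\<in>?G. restrict (\<lambda>i. map g [0..<?n] ! i) {0..<?n} = g"
      by (auto simp: fun_eq_iff PiE_def extensional_def)
    show "\<forall>js\<in>assignments ?xs (lookup alpha). map (restrict (\<lambda>i. js ! i) {0..<?n}) [0..<?n] = js"
      by (auto simp: assignments_def intro!: nth_equalityI)
    show "(\<lambda>g. map g [0..<?n]) ` ?G \<subseteq> assignments ?xs (lookup alpha)"
    proof (rule image_subsetI)
      fix g assume "g \<in> ?G"
      moreover have "(\<Sum>i<?n. if map g [0..<?n] ! i = j then ?xs ! i else 0) = (\<Sum>i<?n. if g i = j then ?xs ! i else 0)" for j
        by (rule sum.cong) auto
      ultimately show "map g [0..<?n] \<in> assignments ?xs (lookup alpha)"
        unfolding conv by (simp add: assignments_def)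
    qed
    show "(\<lambda>js. restrict (\<lambda>i. js ! i) {0..<?n}) ` assignments ?xs (lookup alpha) \<subseteq> ?G"
    proof (rule image_subsetI)
      fix js assume js: "js \<in> assignments ?xs (lookup alpha)"
      have sum: "(\<Sum>i<?n. if js ! i = j then ?xs ! i else 0) = lookup alpha j" for j
        using js by (simp add: assignments_def)
      have "js ! i \<in> keys alpha" if i: "i < ?n" for i
      proof -
        have "0 < ?xs ! i" using assms nth_mem[OF i] by (simp add: is_partition_def)
        also have "?xs ! i \<le> (\<Sum>l<?n. if js ! l = js ! i then ?xs ! l else 0)"
          using member_le_sum[of i "{..<?n}" "\<lambda>l. if js ! l = js ! i then ?xs ! l else 0"] i by simp
        finally show ?thesis by (simp add: sum in_keys_iff)
      qed
      moreover have "(\<Sum>i<?n. if restrict (\<lambda>i. js ! i) {0..<?n} i = j then ?xs ! i else 0) =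
          (\<Sum>i<?n. if js ! i = j then ?xs ! i else 0)" for j
        by (rule sum.cong) auto
      ultimately show "restrict (\<lambda>i. js ! i) {0..<?n} \<in> ?G"
        using sum unfolding conv by auto
    qed
  qed
  then show ?thesis unfolding pcoeff_def by (rule bij_betw_same_card)
qed

lemma expo_part_surj:
  assumes "is_partition lam"
  obtains alpha where "expo_part alpha = lam"
proof -
  define alpha where "alpha = Poly_Mapping.nth (parts lam)"
  have pos: "0 < parts lam ! i" if "i < length (parts lam)" for i
    using assms nth_mem[OF that] by (simp add: is_partition_def)
  have lk: "lookup alpha i = (if i < length (parts lam) then parts lam ! i else 0)" for i
    by (simp add: alpha_def Poly_Mapping.lookup_nth nth_default_def)
  have "keys alpha = {0..<length (parts lam)}"
    using pos by (auto simp: in_keys_iff lk split: if_splits)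
  then have "expo_part alpha = image_mset (\<lambda>i. parts lam ! i) (mset_set {0..<length (parts lam)})"
    unfolding expo_part_def by (auto simp: lk intro!: image_mset_cong)
  also have "\<dots> = mset (map (\<lambda>i. parts lam ! i) [0..<length (parts lam)])"
    by (simp only: mset_map mset_upt)
  also have "\<dots> = lam" by (simp only: map_nth mset_parts)
  finally show ?thesis by (rule that)
qed

lemma is_partition_expo_part: "is_partition (expo_part alpha)"
  by (auto simp: is_partition_def expo_part_def in_keys_iff)

context hall_littlewood
begin

text \<open>This is the duality of monomials and products of q functions. Assigning the first part x
  to a variable j lowers a_j by x; the adjoint of p_x is a derivative, and by the Leibniz rule it
  lowers one index by x, with the constants (1-t^x)/x and x/(1-t^x) cancelling.\<close>

lemma hall_psym_prod_qz:
  assumes "0 \<notin> set xs" "finite J" "\<And>j. j \<notin> J \<Longrightarrow> a j = 0"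
  shows "finite (assignments xs a) \<and>
    of_nat (card (assignments xs a)) = hall t (psym (mset xs)) (\<Prod>j\<in>J. qz 1 (int (a j)))"
  using assms(1,3)
proof (induction xs arbitrary: a)
  case Nil
  have g: "(\<Prod>j\<in>J. qz 1 (int (a j))) \<in> homog (\<Sum>j\<in>J. int (a j))"
    using \<open>finite J\<close> by (induction J rule: finite_induct) (auto intro: homog_mult homog_qz)
  show ?case
  proof (cases "\<forall>j\<in>J. a j = 0")
    case True
    then have "\<forall>j. a j = 0" using Nil by blast
    then have "assignments [] a = {[]}" by (auto simp: assignments_def)
    then show ?thesis using True by (simp add: hall_1_left)
  next
    case False
    then have "assignments [] a = {}" by (force simp: assignments_def)
    moreover have "(\<Sum>j\<in>J. int (a j)) \<noteq> 0" using False \<open>finite J\<close> by (subst sum_nonneg_eq_0_iff) auto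
    then have "hall t 1 (\<Prod>j\<in>J. qz 1 (int (a j))) = 0"
      using hall_homog_orthogonal[OF homog_1 g] by simp
    ultimately show ?thesis by simp
  qed
next
  case (Cons x xs)
  let ?a = "\<lambda>j. a(j := a j - x)" and ?J = "{j \<in> J. x \<le> a j}"
  have x: "x \<noteq> 0" using Cons.prems by auto
  have IH: "finite (assignments xs (?a j)) \<and>
    of_nat (card (assignments xs (?a j))) = hall t (psym (mset xs)) (\<Prod>i\<in>J. qz 1 (int (?a j i)))" if "j \<in> J" for j
    using Cons.prems that by (intro Cons.IH) auto
  have eq: "assignments (x # xs) a = (\<Union>j\<in>?J. (#) j ` assignments xs (?a j))"
    by (rule assignments_Cons[OF x]) (rule Cons.prems(2))
  have "card (assignments (x # xs) a) = (\<Sum>j\<in>?J. card ((#) j ` assignments xs (?a j)))"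
    unfolding eq by (rule card_UN_disjoint) (use IH \<open>finite J\<close> in auto)
  also have "\<dots> = (\<Sum>j\<in>?J. card (assignments xs (?a j)))"
    by (intro sum.cong refl card_image) auto
  finally have "of_nat (card (assignments (x # xs) a)) =
      (\<Sum>j\<in>?J. hall t (psym (mset xs)) (\<Prod>i\<in>J. qz 1 (int (?a j i))))"
    using IH by simp
  also have "\<dots> = (\<Sum>j\<in>?J. hall t (psym (mset xs)) (qz 1 (int (a j) - int x) * (\<Prod>i\<in>J - {j}. qz 1 (int (a i)))))"
  proof (rule sum.cong[OF refl])
    fix j assume j: "j \<in> ?J"
    have "(\<Prod>i\<in>J. qz 1 (int (?a j i))) = qz 1 (int (?a j j)) * (\<Prod>i\<in>J - {j}. qz 1 (int (?a j i)))"
      using j \<open>finite J\<close> by (intro prod.remove) auto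
    also have "(\<Prod>i\<in>J - {j}. qz 1 (int (?a j i))) = (\<Prod>i\<in>J - {j}. qz 1 (int (a i)))"
      by (rule prod.cong) auto
    finally show "hall t (psym (mset xs)) (\<Prod>i\<in>J. qz 1 (int (?a j i))) =
      hall t (psym (mset xs)) (qz 1 (int (a j) - int x) * (\<Prod>i\<in>J - {j}. qz 1 (int (a i))))"
      using j by (simp add: of_nat_diff)
  qed
  \<comment> \<open>A variable with a_j < x cannot receive x, and its term vanishes because the
    integer index is negative.\<close>
  also have "\<dots> = (\<Sum>j\<in>J. hall t (psym (mset xs)) (qz 1 (int (a j) - int x) * (\<Prod>i\<in>J - {j}. qz 1 (int (a i)))))"
  proof (rule sum.mono_neutral_left)
    show "\<forall>j\<in>J - ?J. hall t (psym (mset xs)) (qz 1 (int (a j) - int x) * (\<Prod>i\<in>J - {j}. qz 1 (int (a i)))) = 0"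
    proof
      fix j assume "j \<in> J - ?J"
      then have "int (a j) - int x < 0" by auto
      then show "hall t (psym (mset xs)) (qz 1 (int (a j) - int x) * (\<Prod>i\<in>J - {j}. qz 1 (int (a i)))) = 0"
        by (simp only: qz_neg mult_zero_left hall_0_right)
    qed
  qed (use \<open>finite J\<close> in auto)
  also have "\<dots> = of_nat x / (1 - t ^ x) * hall t (psym (mset xs)) (pderiv_sym x (\<Prod>j\<in>J. qz 1 (int (a j))))"
    using x t_power[of x]
    by (simp add: pderiv_sym_prod[OF \<open>finite J\<close> valid_qz] pderiv_qz hall_sum_right sum_distrib_left)
  also have "\<dots> = hall t (psym (mset (x # xs))) (\<Prod>j\<in>J. qz 1 (int (a j)))"
    by (simp add: hall_pvar_mult psym_add_mset[of x "mset xs"])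
  finally show ?case using IH \<open>finite J\<close> unfolding eq by auto
qed

lemma mcoeff_eq_hall:
  assumes "valid_sym f"
  shows "mcoeff f alpha = hall t f (qmul (expo_part alpha))"
proof -
  have *: "of_nat (pcoeff lam alpha) = hall t (psym lam) (qmul (expo_part alpha))" if "is_partition lam" for lam
  proof -
    have "qmul (expo_part alpha) = (\<Prod>j\<in>keys alpha. qz 1 (int (lookup alpha j)))"
      by (simp add: qmul_def expo_part_def prod_unfold_prod_mset image_mset.compositionality comp_def)
    then show ?thesis
      using hall_psym_prod_qz[of "parts lam" "keys alpha" "lookup alpha"] that
      by (auto simp: pcoeff_eq_card_assignments in_keys_iff is_partition_def)
  qed
  have "hall t (\<Sum>lam\<in>keys f. scal (lookup f lam) (psym lam)) (qmul (expo_part alpha)) = mcoeff f alpha"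
    using assms by (auto simp: hall_sum_left mcoeff_def valid_sym_def * intro!: sum.cong)
  then show ?thesis by (simp only: sym_expand[symmetric])
qed

section \<open>Identification of the Hall-Littlewood functions\<close>

definition vP :: "nat multiset \<Rightarrow> 'a sym" where
  "vP lam = (if is_partition lam then scal (inverse (hall t (vQ lam) (vQ lam))) (vQ lam) else 0)"

lemma vP_homog: "vP lam \<in> homog (int (sum_mset lam))"
  by (auto simp: vP_def intro: homog_scal vQ_homog)

lemma hall_vP_vQ:
  assumes "is_partition lam" "is_partition mu"
  shows "hall t (vP lam) (vQ mu) = (if lam = mu then 1 else 0)"
  using assms hall_vQ[OF assms] by (auto simp: vP_def)

lemma vP_family: "HL_P_family t vP"
  unfolding HL_P_family_def
proof (intro conjI allI impI)
  fix lam mu :: "nat multiset" assume *: "is_partition lam \<and> is_partition mu \<and> lam \<noteq> mu"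
  then show "hall t (vP lam) (vP mu) = 0" using hall_vQ[of lam mu] by (auto simp: vP_def)
next
  fix lam :: "nat multiset" assume lam: "is_partition lam"
  show valid: "valid_sym (vP lam)" by (rule valid_homog[OF vP_homog])
  fix alpha
  show "mcoeff (vP lam) alpha = 1" if "expo_part alpha = lam"
    unfolding mcoeff_eq_hall[OF valid] that using lam hall_vQ[OF lam lam] by (simp add: vP_def hall_vQ_qmul_self)
  show "mcoeff (vP lam) alpha = 0" if "\<not> dominated (expo_part alpha) lam"
    unfolding mcoeff_eq_hall[OF valid]
    using lam that hall_vQ_qmul[OF lam is_partition_expo_part] by (simp add: vP_def)
qed (simp add: vP_def)

lemma HL_P_family_qmul:
  assumes P: "HL_P_family t P" and lam: "is_partition lam" and nu: "is_partition nu"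
  shows "nu = lam \<Longrightarrow> hall t (P lam) (qmul nu) = 1"
    and "\<not> dominated nu lam \<Longrightarrow> hall t (P lam) (qmul nu) = 0"
proof -
  obtain alpha where alpha: "expo_part alpha = nu" using expo_part_surj[OF nu] .
  have "valid_sym (P lam)" using P lam by (simp add: HL_P_family_def)
  then have "hall t (P lam) (qmul nu) = mcoeff (P lam) alpha" by (simp add: mcoeff_eq_hall alpha)
  then show "nu = lam \<Longrightarrow> hall t (P lam) (qmul nu) = 1"
    and "\<not> dominated nu lam \<Longrightarrow> hall t (P lam) (qmul nu) = 0"
    using P lam alpha by (auto simp: HL_P_family_def)
qed

text \<open>The difference is tested against every \<open>vQ mu\<close>. For mu strictly below lam,
  orthogonality and the induction hypothesis for mu apply. Otherwise \<open>vQ mu\<close> is a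
  combination of products q_nu with nu above mu, on which normalisation and triangularity determine
  both pairings.\<close>

lemma HL_P_family_unique:
  assumes P: "HL_P_family t P"
  shows "P = vP"
proof
  fix lam
  have "P lam = vP lam" if "is_partition lam"
    using that
  proof (induction "card {mu \<in> partitions (sum_mset lam). dominated mu lam}" arbitrary: lam rule: less_induct)
    case less
    note lam = less.prems
    have "P lam - vP lam = 0"
    proof (rule sym_eq_0_hall_vQ)
      show "valid_sym (P lam - vP lam)"
        using P lam valid_homog[OF vP_homog] by (intro valid_sym_diff) (auto simp: HL_P_family_def)
      fix mu :: "nat multiset" assume mu: "is_partition mu"
      show "hall t (P lam - vP lam) (vQ mu) = 0"
      proof (cases "dominated mu lam \<and> mu \<noteq> lam")
        case True
        have eq: "sum_mset mu = sum_mset lam" using True by (simp add: dominated_def)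
        have "\<not> dominated lam mu" using True mu dominated_antisym lam by blast
        moreover have "lam \<in> partitions (sum_mset lam)" using lam by (simp add: partitions_def)
        ultimately have "{rho \<in> partitions (sum_mset mu). dominated rho mu} \<subset> {rho \<in> partitions (sum_mset lam). dominated rho lam}"
          using True dominated_trans dominated_refl unfolding eq by blast
        then have "card {rho \<in> partitions (sum_mset mu). dominated rho mu} < card {rho \<in> partitions (sum_mset lam). dominated rho lam}"
          by (rule psubset_card_mono[rotated]) simp
        then have "P mu = vP mu" using mu by (rule less.hyps)
        moreover have "hall t (P lam) (P mu) = 0" using P lam mu True by (auto simp: HL_P_family_def)
        ultimately have "hall t (P lam) (vQ mu) = 0" using mu hall_vQ[OF mu mu] by (simp add: vP_def)
        then show ?thesis using hall_vP_vQ[OF lam mu] True by (auto simp: hall_minus_left)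
      next
        case False
        \<comment> \<open>If nu lies below lam, then so does mu; by the case assumption mu = lam,
          and hence nu = lam.\<close>
        have q: "hall t (P lam - vP lam) (qmul nu) = 0" if nu: "is_partition nu" "dominated mu nu" for nu
        proof (cases "dominated nu lam")
          case True
          then have "mu = lam" using False nu dominated_trans by blast
          then have "nu = lam" using nu True dominated_antisym lam by blast
          then show ?thesis
            using HL_P_family_qmul(1)[OF P lam nu(1)] HL_P_family_qmul(1)[OF vP_family lam nu(1)]
            by (simp add: hall_minus_left)
        next
          case False
          then show ?thesis
            using HL_P_family_qmul(2)[OF P lam nu(1)] HL_P_family_qmul(2)[OF vP_family lam nu(1)]
            by (simp add: hall_minus_left)
        qed
        have "hall t (P lam - vP lam) (vQ mu - qmul mu) = 0"
          by (rule hall_span_eq_0[OF vQ_triangular[OF mu]]) (auto simp: qup_def q)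
        then show ?thesis using q[OF mu dominated_refl] by (simp add: hall_minus_right)
      qed
    qed
    then show ?case by simp
  qed
  then show "P lam = vP lam" using P by (cases "is_partition lam") (auto simp: HL_P_family_def vP_def)
qed

lemma HL_P_eq: "HL_P t = vP"
  unfolding HL_P_def by (rule the_equality[where P = "HL_P_family t", OF vP_family]) (rule HL_P_family_unique)

lemma HL_Q_eq: "is_partition lam \<Longrightarrow> HL_Q t lam = vQ lam"
  using hall_vQ[of lam lam] by (simp add: HL_Q_def HL_P_eq vP_def)

lemma homog_expand_vP:
  assumes "f \<in> homog (int n)"
  shows "f = (\<Sum>mu\<in>partitions n. scal (hall t f (vQ mu)) (vP mu))" (is "f = ?s")
proof -
  have "f - ?s = 0"
  proof (rule sym_eq_0_hall_vQ)
    show "valid_sym (f - ?s)"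
      using valid_homog[OF assms] valid_homog[OF vP_homog]
      by (intro valid_sym_diff valid_sym_sum valid_sym_scal) auto
    fix nu :: "nat multiset" assume nu: "is_partition nu"
    have "hall t ?s (vQ nu) = (\<Sum>mu\<in>partitions n. if mu = nu then hall t f (vQ nu) else 0)"
      using nu by (auto simp: hall_sum_left hall_vP_vQ partitions_def intro!: sum.cong)
    also have "\<dots> = (if nu \<in> partitions n then hall t f (vQ nu) else 0)" by simp
    also have "\<dots> = hall t f (vQ nu)"
      using hall_homog_orthogonal[OF assms vQ_homog, of nu] nu by (auto simp: partitions_def)
    finally show "hall t (f - ?s) (vQ nu) = 0" by (simp add: hall_minus_left)
  qed
  then show ?thesis by simp
qed

lemma homog_expand_vQ:
  assumes "f \<in> homog (int n)"
  shows "f = (\<Sum>mu\<in>partitions n. scal (hall t f (vP mu)) (vQ mu))"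
proof -
  have "(\<Sum>mu\<in>partitions n. scal (hall t f (vP mu)) (vQ mu)) = (\<Sum>mu\<in>partitions n. scal (hall t f (vQ mu)) (vP mu))"
    by (rule sum.cong) (auto simp: vP_def partitions_def)
  then show ?thesis using homog_expand_vP[OF assms] by simp
qed

text \<open>Duality of \<open>vP\<close> and \<open>vQ\<close> makes every admissible coefficient
  equal to this pairing, which settles the definite description.\<close>

lemma Pcoeff_eq:
  assumes "is_partition lam" "f \<in> homog (int (sum_mset lam))"
  shows "Pcoeff t f lam = hall t f (vQ lam)"
  unfolding Pcoeff_def HL_P_eq
proof (rule the_equality)
  let ?a = "\<lambda>k. if k \<in> partitions (sum_mset lam) then hall t f (vQ k) else 0"
  have "f = (\<Sum>k\<in>partitions (sum_mset lam). scal (?a k) (vP k))"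
    using homog_expand_vP[OF assms(2)] by simp
  moreover have "hall t f (vQ lam) = ?a lam" using assms(1) by (simp add: partitions_def)
  ultimately show "\<exists>a. (\<forall>k. k \<notin> partitions (sum_mset lam) \<longrightarrow> a k = 0) \<and>
      f = (\<Sum>k\<in>partitions (sum_mset lam). scal (a k) (vP k)) \<and> hall t f (vQ lam) = a lam"
    by (intro exI[of _ ?a]) auto
next
  fix c assume "\<exists>a. (\<forall>k. k \<notin> partitions (sum_mset lam) \<longrightarrow> a k = 0) \<and>
      f = (\<Sum>k\<in>partitions (sum_mset lam). scal (a k) (vP k)) \<and> c = a lam"
  then obtain a where a: "f = (\<Sum>k\<in>partitions (sum_mset lam). scal (a k) (vP k))" "c = a lam" by blast
  have "hall t f (vQ lam) = (\<Sum>k\<in>partitions (sum_mset lam). if k = lam then a k else 0)"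
    unfolding a(1) using assms(1) by (auto simp: hall_sum_left hall_vP_vQ partitions_def intro!: sum.cong)
  also have "\<dots> = (if lam \<in> partitions (sum_mset lam) then a lam else 0)" by simp
  also have "\<dots> = c" using assms(1) a(2) by (simp add: partitions_def)
  finally show "c = hall t f (vQ lam)" by simp
qed

end

section \<open>Straightening and containment\<close>

lemma not_sorted_adjacent:
  fixes ys :: "nat list"
  assumes "\<not> sorted_wrt (\<ge>) ys"
  obtains us s r vs where "ys = us @ s # r # vs" "s < r"
  using assms
proof (induction ys arbitrary: thesis)
  case (Cons x ys)
  show ?case
  proof (cases "sorted_wrt (\<ge>) ys")
    case True
    then obtain y zs where ys: "ys = y # zs" using Cons.prems(2) by (cases ys) auto
    have "x < y"
    proof (rule ccontr)
      assume "\<not> x < y"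
      then have "sorted_wrt (\<ge>) (x # ys)" using True ys by auto
      then show False using Cons.prems(2) by simp
    qed
    then show ?thesis using Cons.prems(1)[of "[]" x y zs] ys by simp
  next
    case False
    then obtain us s r vs where "ys = us @ s # r # vs" "s < r" by (rule Cons.IH[rotated])
    then show ?thesis using Cons.prems(1)[of "x # us" s r vs] by simp
  qed
qed simp

text \<open>The sum of i times the entry at position i, counted from 0. It drops when an adjacent
  pair keeps its sum and its second entry decreases.\<close>

fun tail_weight :: "nat list \<Rightarrow> nat" where
  "tail_weight [] = 0"
| "tail_weight (x # xs) = sum_list xs + tail_weight xs"

lemma tail_weight_less:
  "a + b = s + r \<Longrightarrow> b < r \<Longrightarrow> tail_weight (us @ a # b # vs) < tail_weight (us @ s # r # vs)"
  by (induction us) auto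

lemma nth_default_filter_pos:
  assumes "sorted_wrt (\<ge>) zs"
  shows "nth_default 0 (filter ((<) 0) zs) i = nth_default (0::nat) zs i"
  using assms
proof (induction zs arbitrary: i)
  case (Cons z zs)
  show ?case
  proof (cases "z = 0")
    case True
    then have "\<forall>x\<in>set (z # zs). x = 0" using Cons.prems by auto
    moreover from this have "filter ((<) 0) (z # zs) = []" by (auto simp: filter_empty_conv)
    moreover have "nth_default 0 (z # zs) i = 0"
      using calculation(1) nth_mem[of i "z # zs"] by (auto simp: nth_default_def simp del: nth_Cons_0)
    ultimately show ?thesis by simp
  next
    case False
    then show ?thesis using Cons by (cases i) auto
  qed
qed simp

lemma part_eq_nth_default: "part lam i = nth_default 0 (parts lam) i"
  by (simp add: part_def nth_default_def)

context hall_littlewood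
begin

lemma vop_1: "vop 1 n 1 = qz 1 n"
  using vop_homog_eq[OF homog_1, of 0 1 n] by (simp add: transl_1)

lemma vop_qz_mult:
  assumes f: "f \<in> homog (int D)"
  shows "vop 1 n (qz 1 (int r) * f) = (\<Sum>k\<le>r. scal (ccoef 1 k) (qz 1 (int r - int k) * vop 1 (n + int k) f))"
proof -
  let ?g = "\<lambda>k i. scal (ccoef 1 k) (qz 1 (int r - int k) * (qz 1 (n + int k + int i) * transl 1 i f))"
  have "vop 1 n (qz 1 (int r) * f) = (\<Sum>i\<le>r + D. qz 1 (n + int i) * transl 1 i (qz 1 (int r) * f))"
    by (rule vop_homog_eq[OF homog_mult[OF homog_qz f]]) simp
  also have "\<dots> = (\<Sum>i\<le>r + D. \<Sum>k\<le>i. ?g k (i - k))"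
    unfolding transl_mult transl_qz sum_distrib_left
    by (intro sum.cong refl) (simp add: of_nat_diff mult.left_commute)
  also have "\<dots> = (\<Sum>k\<le>r + D. \<Sum>i\<le>r + D - k. ?g k i)"
    by (rule sum_triangle[of ?g])
  also have "\<dots> = (\<Sum>k\<le>r. \<Sum>i\<le>r + D - k. ?g k i)"
    by (intro sum.mono_neutral_right) (auto intro!: sum.neutral)
  also have "\<dots> = (\<Sum>k\<le>r. scal (ccoef 1 k) (qz 1 (int r - int k) * vop 1 (n + int k) f))"
  proof (rule sum.cong[OF refl])
    fix k assume "k \<in> {..r}"
    then have "vop 1 (n + int k) f = (\<Sum>i\<le>r + D - k. qz 1 (n + int k + int i) * transl 1 i f)"
      by (intro vop_homog_eq[OF f]) simp
    then show "(\<Sum>i\<le>r + D - k. ?g k i) = scal (ccoef 1 k) (qz 1 (int r - int k) * vop 1 (n + int k) f)"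
      by (simp add: sum_distrib_left sym.scale_sum_right)
  qed
  finally show ?thesis .
qed

text \<open>In \<open>vop_qz_mult\<close> the term k = 0 is the wanted product and the others have a
  smaller q index, so the relation can be solved recursively. Operator indices are only ever
  raised.\<close>

lemma qz_mult_vop:
  assumes f: "f \<in> homog (int D)"
  shows "qz 1 (int r) * vop 1 (int n) f \<in> sym.span {vop 1 (int (n + k)) (qz 1 (int (r - k)) * f) | k. k \<le> r}"
proof (induction r arbitrary: n rule: less_induct)
  case (less r)
  let ?S = "\<lambda>n r. {vop 1 (int (n + k)) (qz 1 (int (r - k)) * f) | k. k \<le> r}"
  have "vop 1 (int n) (qz 1 (int r) * f) = qz 1 (int r) * vop 1 (int n) f +
    (\<Sum>k = 1..r. scal (ccoef 1 k) (qz 1 (int r - int k) * vop 1 (int n + int k) f))"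
    unfolding vop_qz_mult[OF f] by (simp add: atMost_atLeast0 sum.atLeast_Suc_atMost)
  then have "qz 1 (int r) * vop 1 (int n) f = vop 1 (int n) (qz 1 (int r) * f) -
    (\<Sum>k = 1..r. scal (ccoef 1 k) (qz 1 (int r - int k) * vop 1 (int n + int k) f))" by simp
  also have "\<dots> \<in> sym.span (?S n r)"
  proof (intro sym.span_diff sym.span_sum sym.span_scale)
    show "vop 1 (int n) (qz 1 (int r) * f) \<in> sym.span (?S n r)"
      by (intro sym.span_base CollectI exI[of _ 0]) simp
    fix k assume k: "k \<in> {1..r}"
    have "qz 1 (int (r - k)) * vop 1 (int (n + k)) f \<in> sym.span (?S (n + k) (r - k))"
      by (rule less) (use k in auto)
    moreover have "?S (n + k) (r - k) \<subseteq> ?S n r"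
    proof clarify
      fix j assume "j \<le> r - k"
      then show "\<exists>i. vop 1 (int (n + k + j)) (qz 1 (int (r - k - j)) * f) = vop 1 (int (n + i)) (qz 1 (int (r - i)) * f) \<and> i \<le> r"
        using k by (intro exI[of _ "k + j"]) (auto simp: add.assoc)
    qed
    ultimately have "qz 1 (int (r - k)) * vop 1 (int (n + k)) f \<in> sym.span (?S n r)"
      using sym.span_mono by blast
    moreover have "int (r - k) = int r - int k" using k by (simp add: of_nat_diff)
    ultimately show "qz 1 (int r - int k) * vop 1 (int n + int k) f \<in> sym.span (?S n r)"
      by (simp only: of_nat_add)
  qed
  finally show ?case .
qed

text \<open>The q function travels to the right and raises indices on its way. On reaching 1 it
  becomes one further vertex operator, hence the appended entry 0.\<close>

lemma qz_mult_vseq: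
  "qz 1 (int r) * vseq xs \<in> sym.span {vseq ys | ys. list_all2 (\<le>) (xs @ [0]) ys}"
proof (induction xs arbitrary: r)
  case Nil
  have "qz 1 (int r) * vseq [] = vseq [r]" by (simp add: vop_1)
  then show ?case by (intro sym.span_base CollectI exI[of _ "[r]"]) simp
next
  case (Cons n xs)
  show ?case unfolding vseq_Cons
  proof (rule span_map[OF qz_mult_vop[OF vseq_homog], where L = "\<lambda>x. x"])
    fix s assume "s \<in> {vop 1 (int (n + k)) (qz 1 (int (r - k)) * vseq xs) | k. k \<le> r}"
    then obtain k where s: "s = vop 1 (int (n + k)) (qz 1 (int (r - k)) * vseq xs)" by blast
    show "s \<in> sym.span {vseq ys | ys. list_all2 (\<le>) ((n # xs) @ [0]) ys}"
      unfolding s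
    proof (rule span_map[OF Cons.IH])
      fix u assume "u \<in> {vseq ys | ys. list_all2 (\<le>) (xs @ [0]) ys}"
      then obtain ys where "u = vseq ys" "list_all2 (\<le>) (xs @ [0]) ys" by blast
      then show "vop 1 (int (n + k)) u \<in> sym.span {vseq ys | ys. list_all2 (\<le>) ((n # xs) @ [0]) ys}"
        by (intro sym.span_base CollectI exI[of _ "(n + k) # ys"]) simp
    qed (simp_all add: vop_add vop_scal)
  qed simp_all
qed

text \<open>The exchange relation yields the pairs (s+1, r-1), (r-1, s+1) and (r, s). All entries
  are at least s, and the second one is below r as soon as r > s + 1.\<close>

lemma vop_straighten:
  assumes f: "f \<in> homog d" and "s < r"
  shows "vop 1 (int s) (vop 1 (int r) f) \<in>
    sym.span {vop 1 (int a) (vop 1 (int b) f) | a b. a + b = s + r \<and> s \<le> a \<and> s \<le> b \<and> b < r}"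
    (is "_ \<in> sym.span ?S")
proof -
  have mem: "vop 1 (int a) (vop 1 (int b) f) \<in> sym.span ?S" if "a + b = s + r" "s \<le> a" "s \<le> b" "b < r" for a b
    using that by (intro sym.span_base) blast
  have ex: "vop 1 (int s) (vop 1 (int r) f) = scal t (vop 1 (int s + 1) (vop 1 (int r - 1) f))
    - vop 1 (int r - 1) (vop 1 (int s + 1) f) + scal t (vop 1 (int r) (vop 1 (int s) f))"
    by (rule vop_exchange[OF f])
  show ?thesis
  proof (cases "r = Suc s")
    \<comment> \<open>Here the left-hand side reappears on the right with a minus sign, so the
      relation reads 2 X = 2 t Y and is divided by 2.\<close>
    case True
    let ?X = "vop 1 (int s) (vop 1 (int r) f)" and ?Y = "vop 1 (int r) (vop 1 (int s) f)"
    have "?X = scal t ?Y - ?X + scal t ?Y" using ex True by (simp add: add.commute)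
    moreover have "A + A = B + B" if "A = B - A + B" for A B :: "'a sym"
      using arg_cong[OF that, of "\<lambda>z. z + A"] by (simp add: algebra_simps)
    moreover have "scal 2 A = A + A" for A :: "'a sym"
      using sym.scale_left_distrib[of 1 1 A] by simp
    ultimately have "scal 2 ?X = scal 2 (scal t ?Y)" by presburger
    then have "?X = scal t ?Y" by (metis sym.scale_left_imp_eq zero_neq_numeral)
    then show ?thesis using mem[of r s] True by (simp add: sym.span_scale)
  next
    case False
    then have r: "Suc s < r" using assms by simp
    have "int s + 1 = int (Suc s)" "int r - 1 = int (r - 1)" using r by auto
    then show ?thesis unfolding ex
      by (simp only:) (intro sym.span_add sym.span_diff sym.span_scale mem; use r in simp)
  qed
qed

lemma vseq_append: "vseq (us @ vs) = foldr (\<lambda>n. vop 1 (int n)) us (vseq vs)"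
  by (simp add: vseq_def)

text \<open>Ascents are removed one at a time, with \<open>tail_weight\<close> decreasing. The lower
  bound \<open>xs\<close> survives because it is itself decreasing.\<close>

lemma vseq_straighten:
  assumes "sorted_wrt (\<ge>) xs" "list_all2 (\<le>) xs ys"
  shows "vseq ys \<in> sym.span {vseq zs | zs. sorted_wrt (\<ge>) zs \<and> list_all2 (\<le>) xs zs}"
  using assms(2)
proof (induction "tail_weight ys" arbitrary: ys rule: less_induct)
  case less
  let ?S = "{vseq zs | zs. sorted_wrt (\<ge>) zs \<and> list_all2 (\<le>) xs zs}"
  show ?case
  proof (cases "sorted_wrt (\<ge>) ys")
    case True
    then show ?thesis using less.prems by (intro sym.span_base) blast
  next
    case False
    then obtain us s r vs where ys: "ys = us @ s # r # vs" and sr: "s < r"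
      by (rule not_sorted_adjacent)
    let ?L = "foldr (\<lambda>n. vop 1 (int n)) us"
    have lin: "?L (x + y) = ?L x + ?L y" "?L (scal c x) = scal c (?L x)" for x y c
      by (induction us) (simp_all add: vop_add vop_scal)
    have "?L (vop 1 (int s) (vop 1 (int r) (vseq vs))) \<in> sym.span ?S"
    proof (rule span_map[OF vop_straighten[OF vseq_homog sr]])
      fix u assume "u \<in> {vop 1 (int a) (vop 1 (int b) (vseq vs)) | a b. a + b = s + r \<and> s \<le> a \<and> s \<le> b \<and> b < r}"
      then obtain a b where ab: "u = vop 1 (int a) (vop 1 (int b) (vseq vs))" "a + b = s + r" "s \<le> a" "s \<le> b" "b < r"
        by blast
      have "list_all2 (\<le>) xs (us @ a # b # vs)"
      proof -
        obtain us' ws where 1: "xs = us' @ ws" "list_all2 (\<le>) us' us" "list_all2 (\<le>) ws (s # r # vs)"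
          using less.prems ys by (auto simp: list_all2_append2)
        then obtain s' r' vs' where 2: "ws = s' # r' # vs'" "s' \<le> s" "list_all2 (\<le>) vs' vs"
          by (auto simp: list_all2_Cons2)
        \<comment> \<open>Thus s bounds both r' and s' from above, and both new entries are at least
          s.\<close>
        then have "r' \<le> s'" using assms(1) 1 by (simp add: sorted_wrt_append)
        then show ?thesis using 1 2 ab by (auto intro: list_all2_appendI)
      qed
      then have "vseq (us @ a # b # vs) \<in> sym.span ?S"
        using tail_weight_less[OF ab(2,5)] by (intro less.hyps) (simp_all add: ys)
      then show "?L u \<in> sym.span ?S" by (simp add: vseq_append ab(1))
    qed (rule lin)+
    then show ?thesis by (simp add: ys vseq_append)
  qed
qed

text \<open>Zeros stand at the end of a decreasing list, and the operator of index 0 fixes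
  1.\<close>

lemma vseq_filter_pos:
  assumes "sorted_wrt (\<ge>) zs"
  shows "vseq (filter ((<) 0) zs) = vseq zs"
  using assms
proof (induction zs)
  case (Cons z zs)
  show ?case
  proof (cases "z = 0")
    case True
    then have "filter ((<) 0) zs = []" using Cons.prems by (auto simp: filter_empty_conv)
    then show ?thesis using Cons True by (simp add: vop_1)
  qed (use Cons in simp)
qed simp

abbreviation vQ_above :: "nat multiset \<Rightarrow> 'a sym set" where
  "vQ_above mu \<equiv> sym.span {vQ lam | lam. is_partition lam \<and> pcontained mu lam}"

lemma qz_mult_vQ: "qz 1 (int r) * vQ mu \<in> vQ_above mu"
  unfolding vQ_def[of mu]
proof (rule span_map[OF qz_mult_vseq, where L = "\<lambda>x. x"])
  fix s assume "s \<in> {vseq ys | ys. list_all2 (\<le>) (parts mu @ [0]) ys}"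
  then obtain ys where ys: "s = vseq ys" "list_all2 (\<le>) (parts mu @ [0]) ys" by blast
  have sorted: "sorted_wrt (\<ge>) (parts mu @ [0])" by (simp add: sorted_wrt_append sorted_parts)
  show "s \<in> vQ_above mu" unfolding ys(1)
  proof (rule span_map[OF vseq_straighten[OF sorted ys(2)], where L = "\<lambda>x. x"])
    fix u assume "u \<in> {vseq zs | zs. sorted_wrt (\<ge>) zs \<and> list_all2 (\<le>) (parts mu @ [0]) zs}"
    then obtain zs where zs: "u = vseq zs" "sorted_wrt (\<ge>) zs" "list_all2 (\<le>) (parts mu @ [0]) zs" by blast
    let ?lam = "mset (filter ((<) 0) zs)"
    have parts: "parts ?lam = filter ((<) 0) zs"
      by (rule parts_mset) (rule sorted_wrt_filter[OF zs(2)])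
    have "u = vQ ?lam" unfolding vQ_def parts zs(1) by (rule vseq_filter_pos[OF zs(2), symmetric])
    moreover have "is_partition ?lam" by (simp add: is_partition_def)
    moreover have "pcontained mu ?lam"
      unfolding pcontained_def part_eq_nth_default parts nth_default_filter_pos[OF zs(2)]
    proof
      fix i
      have len: "length zs = Suc (length (parts mu))" using list_all2_lengthD[OF zs(3)] by simp
      show "nth_default 0 (parts mu) i \<le> nth_default 0 zs i"
        using list_all2_nthD[OF zs(3), of i] len by (auto simp: nth_default_def nth_append)
    qed
    ultimately show "u \<in> vQ_above mu" by (intro sym.span_base) blast
  qed simp_all
qed simp_all

text \<open>The inverse series is polynomial in the q_i, and multiplication by q_i preserves
  containment of \<open>mu\<close>.\<close>

lemma qz_minus_mult_vQ_above:
  assumes "g \<in> vQ_above mu"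
  shows "qz (- 1) (int k) * g \<in> vQ_above mu"
proof -
  have q: "qz 1 (int r) * g \<in> vQ_above mu" if "g \<in> vQ_above mu" for g r
  proof (rule span_map[OF that])
    fix s assume "s \<in> {vQ lam | lam. is_partition lam \<and> pcontained mu lam}"
    then obtain lam where lam: "s = vQ lam" "pcontained mu lam" by blast
    have "{vQ nu | nu. is_partition nu \<and> pcontained lam nu} \<subseteq> {vQ nu | nu. is_partition nu \<and> pcontained mu nu}"
      using lam(2) unfolding pcontained_def by (blast intro: order_trans)
    then show "qz 1 (int r) * s \<in> vQ_above mu"
      using qz_mult_vQ[of r lam] sym.span_mono lam(1) by blast
  qed (simp_all add: distrib_left)
  show ?thesis
  proof (induction k rule: less_induct)
    case (less k)
    show ?case
    proof (cases "k = 0")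
      case False
      have "qz (- 1) (int k) + (\<Sum>i = 1..k. qz (- 1) (int (k - i)) * qz 1 (int i)) = 0"
        using qz_inverse_nat[of 1 k] False by (simp add: atMost_atLeast0 sum.atLeast_Suc_atMost)
      then have "qz (- 1) (int k) = - (\<Sum>i = 1..k. qz (- 1) (int (k - i)) * qz 1 (int i))"
        by (simp only: add_eq_0_iff2)
      then have "qz (- 1) (int k) * g = - (\<Sum>i = 1..k. qz 1 (int i) * (qz (- 1) (int (k - i)) * g))"
        by (simp add: sum_distrib_right sum_distrib_left mult_ac)
      also have "\<dots> \<in> vQ_above mu"
        by (intro sym.span_neg sym.span_sum q less) (use False in auto)
      finally show ?thesis .
    qed (use assms in simp)
  qed
qed

text \<open>By adjunction this annihilates the coefficient of Q_mu in a translate of Q_lam, unless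
  mu is contained in lam.\<close>

lemma hall_qz_minus_mult_vQ:
  assumes "is_partition lam" "is_partition mu" "\<not> pcontained mu lam"
  shows "hall t (vQ lam) (qz (- 1) (int k) * vQ mu) = 0"
proof (rule hall_span_eq_0[OF qz_minus_mult_vQ_above])
  show "vQ mu \<in> vQ_above mu"
    using assms(2) by (intro sym.span_base) (auto simp: pcontained_def)
  fix s assume "s \<in> {vQ nu | nu. is_partition nu \<and> pcontained mu nu}"
  then obtain nu where "s = vQ nu" "is_partition nu" "pcontained mu nu" by blast
  then show "hall t (vQ lam) s = 0" using assms hall_vQ[of lam nu] by auto
qed

section \<open>The recursion\<close>

text \<open>The coefficient of \<open>qz (- 1) k\<close> at p_lam is (-1)^(number of parts) divided
  by the norm of p_lam.\<close>

lemma ev_neg1_eq_hall: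
  assumes "f \<in> homog (int k)"
  shows "ev_neg1 f = hall t f (qz (- 1) (int k))"
proof -
  have "hall t f (qz (- 1) (int k)) = (\<Sum>lam\<in>keys f. lookup f lam * lookup (qz (- 1) (int k)) lam * pnorm lam)"
    by (rule hall_superset) auto
  also have "\<dots> = ev_neg1 f"
    unfolding ev_neg1_def
  proof (rule sum.cong[OF refl])
    fix lam assume "lam \<in> keys f"
    then have lam: "is_partition lam" "int (sum_mset lam) = int k" using assms by (auto simp: homog_def)
    have "(\<Prod>i\<in>#lam. - 1 * (1 - t ^ i)) = (- 1) ^ size lam * (\<Prod>i\<in>#lam. 1 - t ^ i)"
      by (induction lam) (simp_all add: algebra_simps)
    moreover have "(\<Prod>i\<in>#lam. 1 - t ^ i) \<noteq> 0"
      using lam(1) t_power by (induction lam) auto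
    ultimately have "qcoef (- 1) lam * pnorm lam = (- 1) ^ size lam"
      using zee_nonzero[OF lam(1)] by (simp add: qcoef_def pnorm_def)
    then show "lookup f lam * lookup (qz (- 1) (int k)) lam * pnorm lam = lookup f lam * (- 1) ^ size lam"
      using lam by (simp add: lookup_qz mult.assoc)
  qed
  finally show ?thesis by simp
qed

text \<open>The structure constants are the pairings of P_mu P_rho with Q_nu. Summed against the
  pairings of Q_rho with \<open>qz (- 1) k\<close>, the P_rho reassemble to
  \<open>qz (- 1) k\<close>, which adjunction turns into a translation of Q_nu.\<close>

lemma ev_neg1_skewQ:
  assumes nu: "is_partition nu" and mu: "mu \<in> partitions (sum_mset nu - k)" and k: "k \<le> sum_mset nu"
  shows "ev_neg1 (HL_skewQ t nu mu) = hall t (transl 1 k (vQ nu)) (vP mu)"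
proof -
  have mu': "is_partition mu" "sum_mset mu = sum_mset nu - k" using mu by (auto simp: partitions_def)
  have skew: "HL_skewQ t nu mu = (\<Sum>rho\<in>partitions k. scal (hall t (vP mu * vP rho) (vQ nu)) (vQ rho))"
  proof -
    have "fLR t nu mu rho = hall t (vP mu * vP rho) (vQ nu)" if "rho \<in> partitions k" for rho
    proof -
      have "vP mu * vP rho \<in> homog (int (sum_mset nu))"
        using homog_mult[OF vP_homog vP_homog, of mu rho] that k mu' by (simp add: partitions_def of_nat_diff)
      then show ?thesis unfolding fLR_def HL_P_eq by (rule Pcoeff_eq[OF nu])
    qed
    moreover have "HL_Q t rho = vQ rho" if "rho \<in> partitions k" for rho
      using that by (simp add: HL_Q_eq partitions_def)
    moreover have "sum_mset nu - sum_mset mu = k" "sum_mset mu \<le> sum_mset nu" using k mu' by auto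
    ultimately show ?thesis by (simp add: HL_skewQ_def)
  qed
  have "HL_skewQ t nu mu \<in> homog (int k)"
    unfolding skew using vQ_homog by (intro homog_sum homog_scal) (auto simp: partitions_def)
  then have "ev_neg1 (HL_skewQ t nu mu) = hall t (HL_skewQ t nu mu) (qz (- 1) (int k))"
    by (rule ev_neg1_eq_hall)
  also have "\<dots> = hall t (vP mu * (\<Sum>rho\<in>partitions k. scal (hall t (qz (- 1) (int k)) (vQ rho)) (vP rho))) (vQ nu)"
    unfolding skew sum_distrib_left scal_mult_right hall_sum_left hall_scal_left
    by (rule sum.cong[OF refl]) (simp only: hall_commute[of "qz (- 1) (int k)"] mult.commute)
  also have "(\<Sum>rho\<in>partitions k. scal (hall t (qz (- 1) (int k)) (vQ rho)) (vP rho)) = qz (- 1) (int k)"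
    by (rule homog_expand_vP[OF homog_qz, symmetric])
  also have "hall t (vP mu * qz (- 1) (int k)) (vQ nu) = hall t (transl 1 k (vQ nu)) (vP mu)"
    using hall_transl[OF valid_vQ, of 1 k nu "vP mu"] hall_commute by (metis mult.commute)
  finally show ?thesis .
qed

lemma vQ_head_tail: "vQ lam = vop 1 (int (part lam 0)) (vQ (ptail lam))"
proof (cases "parts lam")
  case Nil
  \<comment> \<open>The largest part defaults to 0 here, and the operator of index 0 maps 1 to
    1.\<close>
  then have "lam = {#}" by (metis mset_parts mset.simps(1))
  then show ?thesis using Nil by (simp add: vQ_def part_def ptail_def vop_1)
next
  case (Cons x xs)
  then have "parts (mset xs) = xs" using sorted_parts[of lam] by (intro parts_mset) simp
  then show ?thesis using Cons by (simp add: vQ_def part_def ptail_def)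
qed

theorem HL_Q_recursion:
  assumes lam: "lam \<in> partitions n"
  shows "HL_Q t lam = (\<Sum>k = 0..n - part lam 0. \<Sum>mu\<in>Cset (n - part lam 0 - k) (ptail lam).
    scal (ev_neg1 (HL_skewQ t (ptail lam) mu)) (qfun t (part lam 0 + k) * HL_Q t mu))"
proof -
  let ?nu = "ptail lam" and ?p = "part lam 0" and ?m = "n - part lam 0"
  have part: "is_partition lam" "sum_mset lam = n" using lam by (auto simp: partitions_def)
  have "parts lam = [] \<or> parts lam = ?p # tl (parts lam)"
    by (cases "parts lam") (auto simp: part_def)
  then have sum: "sum_mset ?nu = ?m"
    using part(2) sum_list_parts[of lam] unfolding ptail_def sum_mset_sum_list
    by (metis add_diff_cancel_left' diff_0_eq_0 list.sel(2) sum_list.Cons sum_list.Nil)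
  have nu: "is_partition ?nu"
    using part(1) list.set_sel(2)[of "parts lam"] unfolding ptail_def is_partition_def
    by (metis list.sel(2) set_mset_mset set_parts)
  have "HL_Q t lam = (\<Sum>k = 0..?m. qz 1 (int ?p + int k) * transl 1 k (vQ ?nu))"
    unfolding HL_Q_eq[OF part(1)] vQ_head_tail[of lam] atMost_atLeast0[symmetric]
    by (rule vop_homog_eq[OF vQ_homog]) (simp add: sum)
  also have "\<dots> = (\<Sum>k = 0..?m. \<Sum>mu\<in>Cset (?m - k) ?nu.
      scal (ev_neg1 (HL_skewQ t ?nu mu)) (qfun t (?p + k) * HL_Q t mu))"
  proof (rule sum.cong[OF refl])
    fix k assume k: "k \<in> {0..?m}"
    let ?T = "transl 1 k (vQ ?nu)"
    have "?T \<in> homog (int (?m - k))"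
    proof -
      have "int (?m - k) = int ?m - int k" by (rule of_nat_diff) (use k in simp)
      then show ?thesis using transl_homog[OF vQ_homog, of 1 k ?nu] by (simp only: sum)
    qed
    then have "?T = (\<Sum>mu\<in>partitions (?m - k). scal (hall t ?T (vP mu)) (vQ mu))"
      by (rule homog_expand_vQ)
    \<comment> \<open>The coefficients dropped here vanish because \<open>mu\<close> is not
      contained in the tail of \<open>lam\<close>.\<close>
    also have "\<dots> = (\<Sum>mu\<in>Cset (?m - k) ?nu. scal (hall t ?T (vP mu)) (vQ mu))"
    proof (rule sum.mono_neutral_right)
      show "\<forall>mu\<in>partitions (?m - k) - Cset (?m - k) ?nu. scal (hall t ?T (vP mu)) (vQ mu) = 0"
      proof
        fix mu assume "mu \<in> partitions (?m - k) - Cset (?m - k) ?nu"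
        then have mu: "is_partition mu" "\<not> pcontained mu ?nu" by (auto simp: Cset_def partitions_def)
        then have "hall t ?T (vP mu) = 0"
          using hall_qz_minus_mult_vQ[OF nu mu, of k] by (simp add: hall_transl valid_vQ vP_def)
        then show "scal (hall t ?T (vP mu)) (vQ mu) = 0" by simp
      qed
    qed (auto simp: Cset_def)
    also have "\<dots> = (\<Sum>mu\<in>Cset (?m - k) ?nu. scal (ev_neg1 (HL_skewQ t ?nu mu)) (HL_Q t mu))"
    proof (rule sum.cong[OF refl])
      fix mu assume "mu \<in> Cset (?m - k) ?nu"
      then have mu: "mu \<in> partitions (?m - k)" by (simp add: Cset_def)
      then have "ev_neg1 (HL_skewQ t ?nu mu) = hall t ?T (vP mu)"
        using k by (intro ev_neg1_skewQ[OF nu]) (simp_all add: sum)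
      then show "scal (hall t ?T (vP mu)) (vQ mu) = scal (ev_neg1 (HL_skewQ t ?nu mu)) (HL_Q t mu)"
        using mu by (simp add: HL_Q_eq partitions_def)
    qed
    finally show "qz 1 (int ?p + int k) * ?T =
      (\<Sum>mu\<in>Cset (?m - k) ?nu. scal (ev_neg1 (HL_skewQ t ?nu mu)) (qfun t (?p + k) * HL_Q t mu))"
      using qz_1_eq_qfun[of "?p + k"] by (simp add: sum_distrib_left)
  qed
  finally show ?thesis .
qed

end

section \<open>Specialisation to the indeterminate t\<close>

lemma tvar_power: "tvar ^ i = Fract ([:0, 1:] ^ i) 1"
  by (induction i) (simp_all add: tvar_def One_fract_def)

interpretation tvar: hall_littlewood tvar
proof
  fix i :: nat assume "0 < i"
  then have "degree ([:0, 1:] ^ i :: rat poly) \<noteq> degree (1 :: rat poly)"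
    by (simp add: degree_power_eq)
  then show "tvar ^ i \<noteq> 1"
    unfolding tvar_power One_fract_def by (auto simp: eq_fract)
qed

theorem theorem5p3:
  fixes lam :: "nat multiset" and n :: nat
  assumes "lam \<in> partitions n"
  shows "HL_Q tvar lam =
    (\<Sum>k = 0..n - part lam 0.
       \<Sum>mu \<in> Cset (n - part lam 0 - k) (ptail lam).
         scal (ev_neg1 (HL_skewQ tvar (ptail lam) mu))
              (qfun tvar (part lam 0 + k) * HL_Q tvar mu))"
  using assms by (rule tvar.HL_Q_recursion)

end
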